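(* Let $A$ be an $n$-qubit algorithm with $A|0^n\rangle=|\psi\rangle=\sum_{x\in\{0,1\}^n}\alpha_x|x\rangle$, let $f:\{0,1\}^n\to\{0,1\}$ define the good states $\{x:f(x)=1\}$, let $\hat{\mathcal{O}}_p$ be a bounded-error oracle for $f$ with $p\in(1/2,1)$, and let $\delta$ be an error parameter. Let $\lambda=\min\{|\alpha_x|^2: f(x)=1\}$ (the minimum probability of a good state, when a good state is present). Then there exists an algorithm that uses $O\Big(\frac{p}{(p-\frac12)^2\sqrt{\lambda}}\log\big(\frac{1}{\lambda\delta}\big)\Big)$ queries to $\hat{\mathcal{O}}_p$ and $n+O\Big(\frac{2p}{(p-1/2)^2}\log\big(\frac{1}{\lambda\delta}\big)\Big)$ qubits, and which outputs a good state with probability at least $1-\delta$ if one exists (i.e. if some $x$ with $f(x)=1$ has $\alpha_x\neq 0$); if there is no good state in $|\psi\rangle$, the algorithm outputs ``No Solution'' with probability at least $1-\delta$.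
   Context: A bounded-error oracle $\hat{\mathcal{O}}_p$ for $f$ (with $p\in(1/2,1)$) is a unitary acting on $|x\rangle|0\rangle$ ($x\in\{0,1\}^n$, one output qubit) as $|x\rangle|0\rangle\mapsto|x\rangle(a_{x,0}|0\rangle+a_{x,1}|1\rangle)$ with $|a_{x,f(x)}|^2\ge p$, i.e. it marks each $x$ correctly with probability at least $p$ and incorrectly with probability at most $1-p$. The algorithm may also use $A$ and $A^\dagger$. *)

theory Defs
  imports Complex_Main
begin

text \<open>A minimal model of quantum query algorithms with intermediate
  measurements and classical control.  Computational basis states of k qubits
  are bool lists of length k; a (possibly unnormalised) state is a function
  from basis strings to amplitudes; a k-qubit operator is given by its matrix
  entries U y x = <y|U|x>.\<close>

type_synonym qstate = "bool list \<Rightarrow> complex"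
type_synonym qop = "bool list \<Rightarrow> bool list \<Rightarrow> complex"

definition basis :: "nat \<Rightarrow> bool list set" where
  "basis k = {xs. length xs = k}"

definition is_unitary :: "nat \<Rightarrow> qop \<Rightarrow> bool" where
  "is_unitary k U \<longleftrightarrow>
     (\<forall>x\<in>basis k. \<forall>x'\<in>basis k.
        (\<Sum>y\<in>basis k. cnj (U y x) * U y x') = (if x = x' then 1 else 0))"

definition adj :: "qop \<Rightarrow> qop" where
  "adj U = (\<lambda>y x. cnj (U x y))"

fun set_pos :: "bool list \<Rightarrow> nat list \<Rightarrow> bool list \<Rightarrow> bool list" where
  "set_pos y (p # ps) (b # zs) = set_pos (y[p := b]) ps zs"
| "set_pos y _ _ = y"

text \<open>Apply a (length ps)-qubit operator G to the qubits at positions ps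
  (tensored with the identity on all other qubits).\<close>
definition apply_on :: "nat list \<Rightarrow> qop \<Rightarrow> qstate \<Rightarrow> qstate" where
  "apply_on ps G v =
     (\<lambda>y. \<Sum>z\<in>basis (length ps). G (map (\<lambda>i. y ! i) ps) z * v (set_pos y ps z))"

definition apply_full :: "nat \<Rightarrow> qop \<Rightarrow> qstate \<Rightarrow> qstate" where
  "apply_full m U v = (\<lambda>y. \<Sum>x\<in>basis m. U y x * v x)"

text \<open>Gates: an arbitrary fixed (input-independent) unitary on the whole
  register, the state preparation A or its inverse on n chosen qubits, or a query
  to the oracle (or its inverse) on n+1 chosen qubits.\<close>
datatype gate =
    Fixed qop
  | UseA "nat list"
  | UseAdjA "nat list"
  | Query "nat list"
  | QueryAdj "nat list"

datatype outcome = Sol "bool list" | NoSolution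

datatype prog =
    Halt outcome
  | Step gate prog
  | Measure nat prog prog

fun gate_sem :: "nat \<Rightarrow> qop \<Rightarrow> qop \<Rightarrow> gate \<Rightarrow> qstate \<Rightarrow> qstate" where
  "gate_sem m A Q (Fixed U) v = apply_full m U v"
| "gate_sem m A Q (UseA ps) v = apply_on ps A v"
| "gate_sem m A Q (UseAdjA ps) v = apply_on ps (adj A) v"
| "gate_sem m A Q (Query ps) v = apply_on ps Q v"
| "gate_sem m A Q (QueryAdj ps) v = apply_on ps (adj Q) v"

definition proj :: "nat \<Rightarrow> bool \<Rightarrow> qstate \<Rightarrow> qstate" where
  "proj i b v = (\<lambda>y. if y ! i = b then v y else 0)"

fun run :: "nat \<Rightarrow> qop \<Rightarrow> qop \<Rightarrow> prog \<Rightarrow> qstate \<Rightarrow> outcome \<Rightarrow> real" where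
  "run m A Q (Halt r) v = (\<lambda>r'. if r' = r then (\<Sum>y\<in>basis m. (cmod (v y))\<^sup>2) else 0)"
| "run m A Q (Step g P) v = run m A Q P (gate_sem m A Q g v)"
| "run m A Q (Measure i P0 P1) v =
     (\<lambda>r. run m A Q P0 (proj i False v) r + run m A Q P1 (proj i True v) r)"

fun is_query :: "gate \<Rightarrow> bool" where
  "is_query (Query _) = True"
| "is_query (QueryAdj _) = True"
| "is_query _ = False"

fun queries :: "prog \<Rightarrow> nat" where
  "queries (Halt _) = 0"
| "queries (Step g P) = (if is_query g then 1 else 0) + queries P"
| "queries (Measure i P0 P1) = max (queries P0) (queries P1)"

fun wf_gate :: "nat \<Rightarrow> nat \<Rightarrow> gate \<Rightarrow> bool" where
  "wf_gate n m (Fixed U) = is_unitary m U"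
| "wf_gate n m (UseA ps) = (distinct ps \<and> length ps = n \<and> set ps \<subseteq> {..<m})"
| "wf_gate n m (UseAdjA ps) = (distinct ps \<and> length ps = n \<and> set ps \<subseteq> {..<m})"
| "wf_gate n m (Query ps) = (distinct ps \<and> length ps = Suc n \<and> set ps \<subseteq> {..<m})"
| "wf_gate n m (QueryAdj ps) = (distinct ps \<and> length ps = Suc n \<and> set ps \<subseteq> {..<m})"

fun wf_prog :: "nat \<Rightarrow> nat \<Rightarrow> prog \<Rightarrow> bool" where
  "wf_prog n m (Halt _) = True"
| "wf_prog n m (Step g P) = (wf_gate n m g \<and> wf_prog n m P)"
| "wf_prog n m (Measure i P0 P1) = (i < m \<and> wf_prog n m P0 \<and> wf_prog n m P1)"

definition init :: "nat \<Rightarrow> qstate" where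
  "init m = (\<lambda>y. if y = replicate m False then 1 else 0)"

text \<open>Bounded-error oracle: a unitary on n+1 qubits mapping |x>|0> to
  |x>(a0|0> + a1|1>) with |a_{f x}|^2 \<ge> p (last qubit = output qubit).\<close>
definition bounded_error_oracle :: "nat \<Rightarrow> real \<Rightarrow> (bool list \<Rightarrow> bool) \<Rightarrow> qop \<Rightarrow> bool" where
  "bounded_error_oracle n p f Q \<longleftrightarrow>
     is_unitary (Suc n) Q \<and>
     (\<forall>x\<in>basis n.
        (\<forall>y\<in>basis (Suc n). Q y (x @ [False]) \<noteq> 0 \<longrightarrow> take n y = x) \<and>
        p \<le> (cmod (Q (x @ [f x]) (x @ [False])))\<^sup>2)"

definition amp :: "nat \<Rightarrow> qop \<Rightarrow> bool list \<Rightarrow> complex" where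
  "amp n A x = A x (replicate n False)"

definition success_prob :: "nat \<Rightarrow> nat \<Rightarrow> qop \<Rightarrow> qop \<Rightarrow> (bool list \<Rightarrow> bool) \<Rightarrow> prog \<Rightarrow> real" where
  "success_prob n m A Q f P = (\<Sum>x\<in>{x\<in>basis n. f x}. run m A Q P (init m) (Sol x))"

definition nosol_prob :: "nat \<Rightarrow> qop \<Rightarrow> qop \<Rightarrow> prog \<Rightarrow> real" where
  "nosol_prob m A Q P = run m A Q P (init m) NoSolution"

end

(* The search follows the robust search of Hoyer, Mosca and de Wolf: amplification by one Grover
   round (a factor of about 3 in amplitude) alternates with b fresh oracle votes, where b is of order
   1/(p - 1/2)^2, so each round of votes shrinks the bad weight by far more than the factor 9 that
   amplification costs.  A state is flagged while every prefix of its votes has a majority of ones.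
   A state that loses its flag never regains it, hence the flagged part is always a scalar multiple
   of the initial state with votes attached, and its weight is a statement about independent votes.
   After some k <= K rounds, with 9^K of order 1/lam, the good flagged weight is bounded below,
   while the bad flagged weights over all rounds have a small sum; one search costs O(b 3^K) queries.
   To reach error delta without another logarithm, candidates are checked by a random walk
   with one majority vote of b queries per step, restarted by a new search at height 0; it runs for
   O(log(1/delta)) steps in total.
   If lam * delta is close to 1 the query bound may be below 1; then a fair coin decides between
   answering "No Solution" and measuring A|0>. *)

theory Submission
  imports Defs "Jordan_Normal_Form.Determinant"
begin

section \<open>Unitary circuits\<close>

text \<open>The best number of rounds depends on the total good weight, of which only the lower
  bound \<open>lam\<close> is known, and too many rounds rotate past the target. No stopping time is
  computed. A search runs through all round numbers from \<open>K\<close> down to 0 and measures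
  after each one, and it is enough that some flagged weight reaches 1/16, which follows by
  contradiction. Checking every candidate to error \<open>\<delta>\<close> by one long vote would
  cost b log(1/delta) queries for each of log(1/delta) candidates, a squared logarithm when
  \<open>lam\<close> is constant. The walk shares the votes between all candidates: bad ones drift
  down to height zero, good ones up to \<open>H\<close>. The program is fixed before
  \<open>A\<close>, \<open>f\<close> and \<open>Q\<close>, so one and the same walk must serve with
  and without a good state. As the register is reset after each full measurement, the walk is a
  classical Markov chain. Amplitudes matter only for its transition probabilities; the rest is
  induction over steps with exponential potentials in the height.\<close>

lemma cnj_mult_self: "cnj z * z = (complex_of_real (cmod z))\<^sup>2"
  using complex_norm_square[of z] by (simp add: mult.commute)

lemma finite_basis [simp]: "finite (basis k)"
  using finite_lists_length_eq[of "UNIV :: bool set" k] by (simp add: basis_def)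

lemma length_basis: "y \<in> basis k \<Longrightarrow> length y = k"
  by (simp add: basis_def)

lemma replicate_basis [simp]: "replicate k b \<in> basis k"
  by (simp add: basis_def)

lemma adj_adj [simp]: "adj (adj U) = U"
  by (simp add: adj_def)

text \<open>\<open>is_unitary\<close> demands orthonormal columns. Orthonormal rows follow because a
  one-sided inverse of a square matrix is two-sided; the enumeration \<open>e\<close> of the basis
  strings carries this over from matrices with numbered rows and columns.\<close>

lemma is_unitary_adj:
  assumes "is_unitary k U"
  shows "is_unitary k (adj U)"
proof -
  obtain e where e: "bij_betw e {0..<card (basis k)} (basis k)"
    using ex_bij_betw_nat_finite[OF finite_basis] by blast
  define N where "N = card (basis k)"
  define M where "M = mat N N (\<lambda>(i,j). U (e i) (e j))"
  define M' where "M' = mat N N (\<lambda>(i,j). cnj (U (e j) (e i)))"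
  have eN: "e i \<in> basis k" if "i < N" for i
    using e that by (auto simp: bij_betw_def N_def)
  have inj: "e i = e j \<longleftrightarrow> i = j" if "i < N" "j < N" for i j
    using e that by (auto simp: bij_betw_def N_def inj_on_def)
  have sum_e: "(\<Sum>y\<in>basis k. h y) = (\<Sum>i<N. h (e i))" for h :: "bool list \<Rightarrow> complex"
    using sum.reindex_bij_betw[OF e, of h] by (simp add: N_def atLeast0LessThan)
  have "M' * M = 1\<^sub>m N"
  proof (rule eq_matI)
    fix i j assume "i < dim_row (1\<^sub>m N :: complex mat)" "j < dim_col (1\<^sub>m N :: complex mat)"
    then have ij: "i < N" "j < N" by auto
    have "(M' * M) $$ (i,j) = (\<Sum>l<N. cnj (U (e l) (e i)) * U (e l) (e j))"
      using ij by (simp add: M_def M'_def scalar_prod_def atLeast0LessThan)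
    also have "\<dots> = (\<Sum>y\<in>basis k. cnj (U y (e i)) * U y (e j))"
      by (simp add: sum_e)
    also have "\<dots> = (if i = j then 1 else 0)"
      using assms ij eN inj unfolding is_unitary_def by simp
    finally show "(M' * M) $$ (i,j) = 1\<^sub>m N $$ (i,j)" using ij by simp
  qed (auto simp: M_def M'_def)
  then have MM: "M * M' = 1\<^sub>m N"
    by (rule mat_mult_left_right_inverse[rotated 2]) (auto simp: M_def M'_def)
  show ?thesis unfolding is_unitary_def adj_def
  proof (intro ballI)
    fix x x' assume x: "x \<in> basis k" "x' \<in> basis k"
    have "basis k = e ` {0..<N}" using e by (simp add: bij_betw_def N_def)
    with x obtain i j where ij: "i < N" "j < N" "x = e i" "x' = e j" by auto
    have "(\<Sum>y\<in>basis k. cnj (cnj (U x y)) * cnj (U x' y)) = (M * M') $$ (i,j)"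
      using ij by (simp add: M_def M'_def scalar_prod_def atLeast0LessThan sum_e)
    also have "\<dots> = (if x = x' then 1 else 0)"
      using ij inj by (simp add: MM)
    finally show "(\<Sum>y\<in>basis k. cnj (cnj (U x y)) * cnj (U x' y)) = (if x = x' then 1 else 0)" .
  qed
qed

lemma is_unitary_rows:
  assumes "is_unitary k U" "x \<in> basis k" "x' \<in> basis k"
  shows "(\<Sum>y\<in>basis k. U x y * cnj (U x' y)) = (if x = x' then 1 else 0)"
  using is_unitary_adj[OF assms(1)] assms(2,3) by (simp add: is_unitary_def adj_def)

section \<open>Replacing bits at chosen positions, and local operators\<close>

lemma length_set_pos [simp]: "length (set_pos y ps z) = length y"
  by (induction y ps z rule: set_pos.induct) auto

lemma nth_set_pos_other: "i \<notin> set ps \<Longrightarrow> set_pos y ps z ! i = y ! i"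
  by (induction y ps z rule: set_pos.induct) auto

lemma nth_set_pos:
  assumes "distinct ps" "length z = length ps" "set ps \<subseteq> {..<length y}" "i < length ps"
  shows "set_pos y ps z ! (ps ! i) = z ! i"
  using assms
proof (induction y ps z arbitrary: i rule: set_pos.induct)
  case (1 y p ps b zs)
  show ?case
  proof (cases i)
    case 0
    then show ?thesis using 1 by (simp add: nth_set_pos_other)
  next
    case (Suc j)
    then show ?thesis using 1 by simp
  qed
qed auto

lemma set_pos_basis [simp]: "y \<in> basis m \<Longrightarrow> set_pos y ps z \<in> basis m"
  by (simp add: basis_def)

context
  fixes ps :: "nat list" and m :: nat
  assumes ps: "distinct ps" "set ps \<subseteq> {..<m}"
begin

lemma read_set_pos:
  assumes "y \<in> basis m" "z \<in> basis (length ps)"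
  shows "map ((!) (set_pos y ps z)) ps = z"
  using assms ps by (intro nth_equalityI) (auto simp: nth_set_pos basis_def)

lemma set_pos_eqI:
  assumes y: "y \<in> basis m" "y' \<in> basis m" and z: "z \<in> basis (length ps)"
    and "\<And>i. i < length ps \<Longrightarrow> y' ! (ps ! i) = z ! i"
    and "\<And>i. i < m \<Longrightarrow> i \<notin> set ps \<Longrightarrow> y' ! i = y ! i"
  shows "set_pos y ps z = y'"
proof (rule nth_equalityI)
  fix i assume "i < length (set_pos y ps z)"
  then have i: "i < m" using y by (simp add: basis_def)
  show "set_pos y ps z ! i = y' ! i"
  proof (cases "i \<in> set ps")
    case True
    then obtain j where "j < length ps" "i = ps ! j" by (auto simp: in_set_conv_nth)
    then show ?thesis using assms ps by (simp add: nth_set_pos basis_def)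
  next
    case False
    then show ?thesis using assms i by (simp add: nth_set_pos_other)
  qed
qed (use y in \<open>simp add: basis_def\<close>)

lemma set_pos_read:
  assumes "y \<in> basis m"
  shows "set_pos y ps (map ((!) y) ps) = y"
  using assms by (intro set_pos_eqI) (auto simp: basis_def)

lemma set_pos_set_pos:
  assumes "y \<in> basis m" "z \<in> basis (length ps)" "z' \<in> basis (length ps)"
  shows "set_pos (set_pos y ps z) ps z' = set_pos y ps z'"
  using assms ps
  by (intro set_pos_eqI) (auto simp: nth_set_pos nth_set_pos_other basis_def)

lemma set_pos_undo:
  assumes "y \<in> basis m" "z \<in> basis (length ps)"
  shows "set_pos (set_pos y ps z) ps (map ((!) y) ps) = y"
proof -
  have "map ((!) y) ps \<in> basis (length ps)" by (simp add: basis_def)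
  then show ?thesis using assms by (simp add: set_pos_set_pos set_pos_read)
qed

lemma apply_on_compose:
  assumes "y \<in> basis m"
  shows "apply_on ps G (apply_on ps H v) y =
    apply_on ps (\<lambda>a c. \<Sum>z\<in>basis (length ps). G a z * H z c) v y"
proof -
  have "apply_on ps G (apply_on ps H v) y =
    (\<Sum>z\<in>basis (length ps). \<Sum>z'\<in>basis (length ps).
      G (map ((!) y) ps) z * H z z' * v (set_pos y ps z'))"
    using assms by (simp add: apply_on_def read_set_pos set_pos_set_pos sum_distrib_left mult.assoc)
  also have "\<dots> = (\<Sum>z'\<in>basis (length ps). \<Sum>z\<in>basis (length ps).
      G (map ((!) y) ps) z * H z z' * v (set_pos y ps z'))"
    by (rule sum.swap)
  finally show ?thesis by (simp add: apply_on_def sum_distrib_right)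
qed

lemma apply_on_inverse:
  assumes y: "y \<in> basis m" and "is_unitary (length ps) U"
  shows "apply_on ps U (apply_on ps (adj U) v) y = v y"
proof -
  have r: "map ((!) y) ps \<in> basis (length ps)" by (simp add: basis_def)
  have "apply_on ps U (apply_on ps (adj U) v) y =
    (\<Sum>z\<in>basis (length ps). (\<Sum>z'\<in>basis (length ps). U (map ((!) y) ps) z' * cnj (U z z'))
       * v (set_pos y ps z))"
    unfolding apply_on_compose[OF y] by (simp add: apply_on_def adj_def)
  also have "\<dots> = (\<Sum>z\<in>basis (length ps). (if map ((!) y) ps = z then v (set_pos y ps z) else 0))"
    by (intro sum.cong) (auto simp: is_unitary_rows[OF assms(2) r])
  also have "\<dots> = v y"
    using r y by (simp add: set_pos_read)
  finally show ?thesis .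
qed

text \<open>Exchanging the bits of \<open>y\<close> at \<open>ps\<close> with \<open>z\<close> is an
  involution on the pairs \<open>(y, z)\<close>. Reindexing the double sum by it transposes the
  matrix entry of \<open>U\<close>.\<close>

lemma apply_on_adjoint:
  "(\<Sum>y\<in>basis m. cnj (apply_on ps U u y) * v y) = (\<Sum>y\<in>basis m. cnj (u y) * apply_on ps (adj U) v y)"
proof -
  let ?S = "basis m \<times> basis (length ps)"
  let ?r = "\<lambda>(y, z). (set_pos y ps z, map ((!) y) ps)"
  have "(\<Sum>y\<in>basis m. cnj (apply_on ps U u y) * v y) =
    (\<Sum>(y,z)\<in>?S. cnj (U (map ((!) y) ps) z) * cnj (u (set_pos y ps z)) * v y)"
    by (simp add: apply_on_def sum_distrib_right sum.cartesian_product)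
  also have "\<dots> = (\<Sum>(y,z)\<in>?S. cnj (u y) * (cnj (U z (map ((!) y) ps)) * v (set_pos y ps z)))"
    by (rule sum.reindex_bij_witness[of _ ?r ?r])
      (auto simp: read_set_pos set_pos_undo, auto simp: basis_def)
  also have "\<dots> = (\<Sum>y\<in>basis m. cnj (u y) * apply_on ps (adj U) v y)"
    by (simp add: apply_on_def adj_def sum_distrib_left sum.cartesian_product)
  finally show ?thesis .
qed

end

lemma apply_on_cong:
  assumes "\<And>y. y \<in> basis m \<Longrightarrow> u y = v y" "y \<in> basis m"
  shows "apply_on ps U u y = apply_on ps U v y"
  using assms by (simp add: apply_on_def)

text \<open>Makes a fixed unitary a local operator on all positions, so that adjoints and inverses
  are treated once for all kinds of gates.\<close>

lemma apply_full_eq: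
  assumes "y \<in> basis m"
  shows "apply_full m U v y = apply_on [0..<m] U v y"
proof -
  have "map ((!) y) [0..<m] = y" using assms map_nth[of y] by (simp add: basis_def)
  moreover have "set_pos y [0..<m] z = z" if "z \<in> basis m" for z
    by (rule set_pos_eqI[of _ m]) (use assms that in \<open>auto simp: basis_def\<close>)
  ultimately show ?thesis by (simp add: apply_full_def apply_on_def)
qed

section \<open>Circuits, their adjoints and inverses\<close>

fun gate_pos :: "nat \<Rightarrow> gate \<Rightarrow> nat list" where
  "gate_pos m (Fixed U) = [0..<m]"
| "gate_pos m (UseA ps) = ps"
| "gate_pos m (UseAdjA ps) = ps"
| "gate_pos m (Query ps) = ps"
| "gate_pos m (QueryAdj ps) = ps"

fun gate_mat :: "qop \<Rightarrow> qop \<Rightarrow> gate \<Rightarrow> qop" where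
  "gate_mat A Q (Fixed U) = U"
| "gate_mat A Q (UseA ps) = A"
| "gate_mat A Q (UseAdjA ps) = adj A"
| "gate_mat A Q (Query ps) = Q"
| "gate_mat A Q (QueryAdj ps) = adj Q"

fun inv_gate :: "gate \<Rightarrow> gate" where
  "inv_gate (Fixed U) = Fixed (adj U)"
| "inv_gate (UseA ps) = UseAdjA ps"
| "inv_gate (UseAdjA ps) = UseA ps"
| "inv_gate (Query ps) = QueryAdj ps"
| "inv_gate (QueryAdj ps) = Query ps"

lemma gate_sem_eq:
  "y \<in> basis m \<Longrightarrow> gate_sem m A Q g v y = apply_on (gate_pos m g) (gate_mat A Q g) v y"
  by (cases g) (auto simp: apply_full_eq)

lemma inv_gate_simps [simp]:
  "gate_pos m (inv_gate g) = gate_pos m g"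
  "gate_mat A Q (inv_gate g) = adj (gate_mat A Q g)"
  "is_query (inv_gate g) = is_query g"
  by (cases g; simp)+

lemma wf_inv_gate [simp]: "wf_gate n m g \<Longrightarrow> wf_gate n m (inv_gate g)"
  by (cases g) (auto simp: is_unitary_adj)

text \<open>A state is a function on strings of every length, but only its values on
  \<open>basis m\<close> are under control. Equality of states is therefore always used in this
  restricted form.\<close>

lemma gate_sem_cong:
  assumes "\<And>y. y \<in> basis m \<Longrightarrow> u y = v y" "y \<in> basis m"
  shows "gate_sem m A Q g u y = gate_sem m A Q g v y"
  by (simp add: gate_sem_eq assms(2)) (rule apply_on_cong[OF assms])

lemma gate_sem_linear:
  "gate_sem m A Q g (\<lambda>y. c * u y + d * v y) =
    (\<lambda>y. c * gate_sem m A Q g u y + d * gate_sem m A Q g v y)"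
  by (cases g)
    (auto simp: apply_full_def apply_on_def fun_eq_iff algebra_simps sum.distrib sum_distrib_left)

lemma gate_sem_adjoint:
  assumes "wf_gate n m g"
  shows "(\<Sum>y\<in>basis m. cnj (gate_sem m A Q g u y) * v y) =
    (\<Sum>y\<in>basis m. cnj (u y) * gate_sem m A Q (inv_gate g) v y)"
proof -
  have "distinct (gate_pos m g)" "set (gate_pos m g) \<subseteq> {..<m}"
    using assms by (cases g; auto)+
  then show ?thesis by (simp add: gate_sem_eq apply_on_adjoint)
qed

lemma gate_sem_inverse:
  assumes "wf_gate n m g" "is_unitary n A" "is_unitary (Suc n) Q" "y \<in> basis m"
  shows "gate_sem m A Q g (gate_sem m A Q (inv_gate g) v) y = v y"
proof -
  have ps: "distinct (gate_pos m g)" "set (gate_pos m g) \<subseteq> {..<m}"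
    using assms(1) by (cases g; auto)+
  have U: "is_unitary (length (gate_pos m g)) (gate_mat A Q g)"
    using assms by (cases g) (auto simp: is_unitary_adj)
  have "gate_sem m A Q g (gate_sem m A Q (inv_gate g) v) y
    = gate_sem m A Q g (apply_on (gate_pos m g) (adj (gate_mat A Q g)) v) y"
    by (rule gate_sem_cong) (auto simp: gate_sem_eq assms(4))
  then show ?thesis
    by (simp add: gate_sem_eq assms(4) apply_on_inverse[OF ps assms(4) U])
qed

definition circ_sem :: "nat \<Rightarrow> qop \<Rightarrow> qop \<Rightarrow> gate list \<Rightarrow> qstate \<Rightarrow> qstate" where
  "circ_sem m A Q gs v = fold (gate_sem m A Q) gs v"

definition inv_circ :: "gate list \<Rightarrow> gate list" where
  "inv_circ gs = rev (map inv_gate gs)"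

lemma circ_sem_Nil [simp]: "circ_sem m A Q [] v = v"
  and circ_sem_Cons [simp]: "circ_sem m A Q (g # gs) v = circ_sem m A Q gs (gate_sem m A Q g v)"
  and circ_sem_append [simp]: "circ_sem m A Q (gs @ hs) v = circ_sem m A Q hs (circ_sem m A Q gs v)"
  by (simp_all add: circ_sem_def)

lemma inv_circ_Cons [simp]: "inv_circ (g # gs) = inv_circ gs @ [inv_gate g]"
  by (simp add: inv_circ_def)

lemma set_inv_circ [simp]: "set (inv_circ gs) = inv_gate ` set gs"
  by (simp add: inv_circ_def)

lemma circ_sem_cong:
  assumes "\<And>y. y \<in> basis m \<Longrightarrow> u y = v y" "y \<in> basis m"
  shows "circ_sem m A Q gs u y = circ_sem m A Q gs v y"
  using assms
proof (induction gs arbitrary: u v)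
  case (Cons g gs)
  show ?case unfolding circ_sem_Cons
    by (rule Cons.IH) (auto intro: gate_sem_cong Cons.prems)
qed auto

lemma circ_sem_linear:
  "circ_sem m A Q gs (\<lambda>y. c * u y + d * v y) =
    (\<lambda>y. c * circ_sem m A Q gs u y + d * circ_sem m A Q gs v y)"
  by (induction gs arbitrary: u v) (auto simp: gate_sem_linear)

lemma circ_sem_adjoint:
  assumes "\<forall>g\<in>set gs. wf_gate n m g"
  shows "(\<Sum>y\<in>basis m. cnj (circ_sem m A Q gs u y) * v y) =
    (\<Sum>y\<in>basis m. cnj (u y) * circ_sem m A Q (inv_circ gs) v y)"
  using assms
proof (induction gs arbitrary: u v)
  case (Cons g gs)
  have "(\<Sum>y\<in>basis m. cnj (circ_sem m A Q gs (gate_sem m A Q g u) y) * v y) =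
    (\<Sum>y\<in>basis m. cnj (gate_sem m A Q g u y) * circ_sem m A Q (inv_circ gs) v y)"
    using Cons by simp
  also have "\<dots> = (\<Sum>y\<in>basis m. cnj (u y) *
      gate_sem m A Q (inv_gate g) (circ_sem m A Q (inv_circ gs) v) y)"
    using Cons.prems by (intro gate_sem_adjoint) auto
  finally show ?case by simp
qed (simp add: inv_circ_def)

context
  fixes n m :: nat and A Q :: qop
  assumes unitary: "is_unitary n A" "is_unitary (Suc n) Q"
begin

lemma circ_sem_inverse:
  assumes "\<forall>g\<in>set gs. wf_gate n m g" "y \<in> basis m"
  shows "circ_sem m A Q gs (circ_sem m A Q (inv_circ gs) v) y = v y"
  using assms
proof (induction gs arbitrary: v y)
  case (Cons g gs)
  have "circ_sem m A Q gs (gate_sem m A Q g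
      (gate_sem m A Q (inv_gate g) (circ_sem m A Q (inv_circ gs) v))) y =
    circ_sem m A Q gs (circ_sem m A Q (inv_circ gs) v) y"
    using Cons.prems by (intro circ_sem_cong gate_sem_inverse[OF _ unitary]) auto
  then show ?case using Cons by simp
qed (simp add: inv_circ_def)

lemma circ_sem_isometry:
  assumes "\<forall>g\<in>set gs. wf_gate n m g"
  shows "(\<Sum>y\<in>basis m. (cmod (circ_sem m A Q gs u y))\<^sup>2) = (\<Sum>y\<in>basis m. (cmod (u y))\<^sup>2)"
proof -
  \<comment> \<open>\<open>circ_sem_inverse\<close> cancels a circuit that runs after its inverse.
    Here the inverse runs last, so the lemma is applied to \<open>hs\<close>, whose own inverse is
    \<open>gs\<close>.\<close>
  define hs where "hs = inv_circ gs"
  have hs: "\<forall>g\<in>set hs. wf_gate n m g" using assms by (auto simp: hs_def)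
  have [simp]: "inv_gate (inv_gate g) = g" for g by (cases g) auto
  have "inv_circ hs = gs"
    by (simp add: hs_def inv_circ_def rev_map comp_def)
  then have "(\<Sum>y\<in>basis m. cnj (circ_sem m A Q gs u y) * circ_sem m A Q gs u y) =
    (\<Sum>y\<in>basis m. cnj (u y) * circ_sem m A Q hs (circ_sem m A Q (inv_circ hs) u) y)"
    using circ_sem_adjoint[OF assms] hs_def by simp
  also have "\<dots> = (\<Sum>y\<in>basis m. cnj (u y) * u y)"
    by (intro sum.cong) (auto simp: circ_sem_inverse[OF hs])
  finally have "complex_of_real (\<Sum>y\<in>basis m. (cmod (circ_sem m A Q gs u y))\<^sup>2) =
    complex_of_real (\<Sum>y\<in>basis m. (cmod (u y))\<^sup>2)"
    by (simp add: cnj_mult_self)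
  then show ?thesis using of_real_eq_iff by blast
qed

end

section \<open>Reflections and one round of amplitude amplification\<close>

definition diag :: "(bool list \<Rightarrow> complex) \<Rightarrow> qop" where
  "diag d = (\<lambda>y x. if y = x then d x else 0)"

lemma apply_full_diag: "y \<in> basis m \<Longrightarrow> apply_full m (diag d) v y = d y * v y"
  by (simp add: apply_full_def diag_def if_distrib[of "\<lambda>c. c * _"] cong: if_cong)

lemma is_unitary_diag:
  assumes "\<And>x. cmod (d x) = 1"
  shows "is_unitary k (diag d)"
proof -
  have "cnj (d x) * d x = 1" for x
    using assms[of x] by (metis complex_norm_square mult.commute of_real_1 power_one)
  moreover have "cnj (diag d y x) * diag d y x' =
      (if x = x' then if y = x then cnj (d x) * d x else 0 else 0)" for x x' y
    by (auto simp: diag_def)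
  ultimately show ?thesis by (simp add: is_unitary_def)
qed

text \<open>The Grover iterate up to a global sign. The second reflection is about the zero string
  of the whole register, so the entire circuit that prepared the state, earlier votes included, has
  to be inverted.\<close>

definition amplify :: "nat \<Rightarrow> (bool list \<Rightarrow> bool) \<Rightarrow> gate list \<Rightarrow> gate list" where
  "amplify m F gs = gs @ [Fixed (diag (\<lambda>y. if F y then -1 else 1))] @ inv_circ gs
    @ [Fixed (diag (\<lambda>y. if y = replicate m False then -1 else 1))] @ gs"

text \<open>The factor \<open>3 - 4 * s\<close> is the triple-angle formula with \<open>s\<close> the squared sine.\<close>
lemma circ_sem_amplify:
  fixes F :: "bool list \<Rightarrow> bool"
  assumes unitary: "is_unitary n A" "is_unitary (Suc n) Q"
    and wf: "\<forall>g\<in>set gs. wf_gate n m g" and y: "y \<in> basis m"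
  defines "\<psi> \<equiv> circ_sem m A Q gs (init m)"
  defines "s \<equiv> (\<Sum>y\<in>{y\<in>basis m. F y}. (cmod (\<psi> y))\<^sup>2)"
  shows "circ_sem m A Q (amplify m F gs) (init m) y =
    of_real (if F y then 4 * s - 3 else 4 * s - 1) * \<psi> y"
proof -
  define w where "w = (\<lambda>y. (if F y then -1 else 1) * \<psi> y)"
  define w' where "w' = circ_sem m A Q (inv_circ gs) w"
  define c where "c = w' (replicate m False)"
  define D where "D = apply_full m (diag (\<lambda>y. if y = replicate m False then -1 else 1)) w'"
  have w'_eq: "circ_sem m A Q (inv_circ gs)
      (apply_full m (diag (\<lambda>y. if F y then - 1 else 1)) \<psi>) x = w' x" if "x \<in> basis m" for x
    unfolding w'_def using that by (intro circ_sem_cong) (auto simp: apply_full_diag w_def)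
  have norm1: "(\<Sum>y\<in>basis m. (cmod (\<psi> y))\<^sup>2) = 1"
    unfolding \<psi>_def circ_sem_isometry[OF unitary wf]
    by (simp add: init_def if_distrib[of "\<lambda>x. cmod x ^ 2"] cong: if_cong)
  \<comment> \<open>The second reflection changes only the amplitude \<open>c\<close> of the zero
    string. Moving the inverse circuit to the other side of the inner product turns \<open>c\<close>
    into the overlap of \<open>\<psi>\<close> with its phase-flipped copy \<open>w\<close>.\<close>
  have "c = (\<Sum>y\<in>basis m. cnj (init m y) * w' y)"
    by (simp add: c_def init_def if_distrib[of "\<lambda>x. cnj x * _"] cong: if_cong)
  also have "\<dots> = (\<Sum>y\<in>basis m. cnj (\<psi> y) * w y)"
    unfolding w'_def \<psi>_def by (rule circ_sem_adjoint[OF wf, symmetric])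
  also have "\<dots> = (\<Sum>y\<in>basis m. of_real ((cmod (\<psi> y))\<^sup>2 - 2 * (if F y then (cmod (\<psi> y))\<^sup>2 else 0)))"
    by (intro sum.cong) (auto simp: w_def cnj_mult_self)
  also have "\<dots> = of_real ((\<Sum>y\<in>basis m. (cmod (\<psi> y))\<^sup>2)
      - 2 * (\<Sum>y\<in>basis m. if F y then (cmod (\<psi> y))\<^sup>2 else 0))"
    unfolding of_real_sum[symmetric] sum_subtractf sum_distrib_left[symmetric] ..
  also have "(\<Sum>y\<in>basis m. if F y then (cmod (\<psi> y))\<^sup>2 else 0) = s"
    unfolding s_def by (simp add: sum.inter_filter)
  finally have c: "c = of_real (1 - 2 * s)" using norm1 by simp
  have "circ_sem m A Q (amplify m F gs) (init m) y =
    circ_sem m A Q gs (apply_full m (diag (\<lambda>y. if y = replicate m False then -1 else 1))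
      (circ_sem m A Q (inv_circ gs) (apply_full m (diag (\<lambda>y. if F y then -1 else 1)) \<psi>))) y"
    by (simp add: amplify_def \<psi>_def)
  also have "\<dots> = circ_sem m A Q gs (\<lambda>y. 1 * w' y + (- 2 * c) * init m y) y"
    by (rule circ_sem_cong[OF _ y]) (auto simp: apply_full_diag w'_eq init_def c_def)
  also have "\<dots> = w y - 2 * c * \<psi> y"
    unfolding circ_sem_linear using circ_sem_inverse[OF unitary wf y]
    by (simp add: w'_def \<psi>_def)
  also have "\<dots> = of_real (if F y then 4 * s - 3 else 4 * s - 1) * \<psi> y"
    by (auto simp: w_def c algebra_simps)
  finally show ?thesis .
qed

section \<open>Measurements\<close>

lemma sum_basis_append:
  "(\<Sum>y\<in>basis (k + l). h y) = (\<Sum>x\<in>basis k. \<Sum>v\<in>basis l. h (x @ v))"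
proof -
  have "(\<Sum>y\<in>basis (k + l). h y) = (\<Sum>(x,v)\<in>basis k \<times> basis l. h (x @ v))"
    by (rule sum.reindex_bij_witness[of _ "\<lambda>(x,v). x @ v" "\<lambda>y. (take k y, drop k y)"])
      (auto simp: basis_def)
  then show ?thesis by (simp add: sum.cartesian_product)
qed

lemma basis_0 [simp]: "basis 0 = {[]}"
  by (auto simp: basis_def)

lemma basis_1: "basis (Suc 0) = {[False], [True]}"
  by (auto simp: basis_def length_Suc_conv)

lemma sum_basis_snoc:
  "(\<Sum>y\<in>basis (Suc k). h y) = (\<Sum>x\<in>basis k. h (x @ [False]) + h (x @ [True]))"
  using sum_basis_append[of h k "Suc 0"] by (simp add: basis_1)

lemma sum_basis_Cons:
  "(\<Sum>y\<in>basis (Suc k). h y) = (\<Sum>x\<in>basis k. h (False # x)) + (\<Sum>x\<in>basis k. h (True # x))"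
  using sum_basis_append[of h "Suc 0" k] by (simp add: basis_1)

text \<open>States are not renormalised after a measurement. The scalar that a branch carries is its
  amplitude, and its square is the probability of the branch.\<close>

lemma run_scale:
  "run m A Q P (\<lambda>y. c * v y) r = (cmod c)\<^sup>2 * run m A Q P v r"
proof (induction P arbitrary: v)
  case (Halt s)
  then show ?case by (simp add: norm_mult power_mult_distrib sum_distrib_left)
next
  case (Step g P)
  have "gate_sem m A Q g (\<lambda>y. c * v y) = (\<lambda>y. c * gate_sem m A Q g v y)"
    using gate_sem_linear[of m A Q g c v 0 v] by simp
  then show ?case using Step by simp
next
  case (Measure i P0 P1)
  have "proj i b (\<lambda>y. c * v y) = (\<lambda>y. c * proj i b v y)" for b
    by (auto simp: proj_def)
  then show ?case using Measure by (simp add: distrib_left)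
qed

lemma run_cong:
  assumes "\<And>y. y \<in> basis m \<Longrightarrow> u y = v y"
  shows "run m A Q P u r = run m A Q P v r"
  using assms
proof (induction P arbitrary: u v)
  case (Step g P)
  then show ?case unfolding run.simps by (intro Step.IH gate_sem_cong)
next
  case (Measure i P0 P1)
  have "proj i b u y = proj i b v y" if "y \<in> basis m" for b y
    using Measure.prems that by (simp add: proj_def)
  then show ?case
    unfolding run.simps using Measure.IH by (intro arg_cong2[of _ _ _ _ "(+)"]) blast+
qed auto

section \<open>Measuring and resetting the whole register\<close>

fun measure_all :: "nat \<Rightarrow> (bool list \<Rightarrow> prog) \<Rightarrow> prog" where
  "measure_all 0 c = c []"
| "measure_all (Suc k) c = Measure k (measure_all k (\<lambda>z. c (z @ [False])))
    (measure_all k (\<lambda>z. c (z @ [True])))"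

lemma run_measure_all:
  assumes "k \<le> m"
  shows "run m A Q (measure_all k c) v r =
    (\<Sum>z\<in>basis k. run m A Q (c z) (\<lambda>y. if take k y = z then v y else 0) r)"
  using assms
proof (induction k arbitrary: c v)
  case (Suc k)
  have *: "run m A Q (c (z @ [b])) (\<lambda>y. if take k y = z then proj k b v y else 0) r =
      run m A Q (c (z @ [b])) (\<lambda>y. if take (Suc k) y = z @ [b] then v y else 0) r" for z b
    by (rule run_cong) (use Suc.prems in \<open>auto simp: basis_def proj_def take_Suc_conv_app_nth\<close>)
  show ?case using Suc by (simp add: * sum_basis_snoc sum.distrib)
qed simp

text \<open>Bitwise exclusive or with \<open>z\<close>, that is, Pauli X on the qubits where
  \<open>z\<close> is set. It serves both to clear a measured register and to load a known string
  into an empty one.\<close>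

definition flip :: "bool list \<Rightarrow> qop" where
  "flip z = (\<lambda>y x. if y = map2 (\<noteq>) z x then 1 else 0)"

lemma map2_neq_involution: "length z = length x \<Longrightarrow> map2 (\<noteq>) z (map2 (\<noteq>) z x) = x"
  by (induction z x rule: list_induct2) auto

lemma map2_neq_self: "map2 (\<noteq>) z z = replicate (length z) False"
  by (induction z) auto

lemma map2_neq_False: "map2 (\<noteq>) z (replicate (length z) False) = z"
  by (induction z) auto

lemma apply_full_flip:
  assumes "z \<in> basis m" "w \<in> basis m"
  shows "apply_full m (flip z) (\<lambda>x. if x = w then c else 0) y =
    (if y = map2 (\<noteq>) z w then c else 0)"
  using assms by (simp add: apply_full_def flip_def if_distrib[of "\<lambda>x. _ * x"] cong: if_cong)

lemma is_unitary_flip: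
  assumes "z \<in> basis m"
  shows "is_unitary m (flip z)"
  unfolding is_unitary_def
proof (intro ballI)
  fix x x' assume x: "x \<in> basis m" "x' \<in> basis m"
  then have eq: "map2 (\<noteq>) z x = map2 (\<noteq>) z x' \<longleftrightarrow> x = x'"
    using assms map2_neq_involution by (metis length_basis)
  have "map2 (\<noteq>) z x \<in> basis m" using assms x by (simp add: basis_def)
  then have "(\<Sum>y\<in>basis m. if y = map2 (\<noteq>) z x then if x = x' then 1 else 0 else 0) =
      (if x = x' then 1 else (0::complex))"
    by simp
  moreover have "cnj (flip z y x) * flip z y x' =
      (if y = map2 (\<noteq>) z x then if x = x' then 1 else 0 else 0)" for y
    using eq by (auto simp: flip_def)
  ultimately show "(\<Sum>y\<in>basis m. cnj (flip z y x) * flip z y x') = (if x = x' then 1 else 0)"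
    by simp
qed

text \<open>Flipping by the measured outcome \<open>y\<close> resets the register to zero.\<close>
definition trial :: "nat \<Rightarrow> gate list \<Rightarrow> (bool list \<Rightarrow> prog) \<Rightarrow> prog" where
  "trial m gs c = foldr Step gs (measure_all m (\<lambda>y. Step (Fixed (flip y)) (c y)))"

lemma run_Steps: "run m A Q (foldr Step gs P) v r = run m A Q P (circ_sem m A Q gs v) r"
  by (induction gs arbitrary: v) auto

text \<open>Every branch restarts from \<open>init m\<close> with its probability as a factor, so a
  program composed of trials behaves like a classical random process.\<close>

lemma run_trial:
  "run m A Q (trial m gs c) v r =
    (\<Sum>y\<in>basis m. (cmod (circ_sem m A Q gs v y))\<^sup>2 * run m A Q (c y) (init m) r)"
proof -
  define w where "w = circ_sem m A Q gs v"
  have "run m A Q (c z) (apply_full m (flip z) (\<lambda>y. if take m y = z then w y else 0)) r =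
      (cmod (w z))\<^sup>2 * run m A Q (c z) (init m) r" if z: "z \<in> basis m" for z
  proof -
    have "run m A Q (c z) (apply_full m (flip z) (\<lambda>y. if take m y = z then w y else 0)) r =
        run m A Q (c z) (\<lambda>y. w z * init m y) r"
    proof (rule run_cong)
      fix y assume "y \<in> basis m"
      have "apply_full m (flip z) (\<lambda>y. if take m y = z then w y else 0) y =
          apply_full m (flip z) (\<lambda>y. if y = z then w z else 0) y"
        by (simp add: apply_full_def basis_def cong: sum.cong)
          (auto intro!: sum.cong)
      then show "apply_full m (flip z) (\<lambda>y. if take m y = z then w y else 0) y = w z * init m y"
        using z map2_neq_self[of z] by (simp add: apply_full_flip init_def basis_def)
    qed
    then show ?thesis by (simp add: run_scale)
  qed
  then show ?thesis by (simp add: trial_def run_Steps run_measure_all flip: w_def)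
qed

definition prob :: "nat \<Rightarrow> qop \<Rightarrow> qop \<Rightarrow> outcome set \<Rightarrow> prog \<Rightarrow> real" where
  "prob m A Q R P = (\<Sum>r\<in>R. run m A Q P (init m) r)"

lemma prob_trial:
  "prob m A Q R (trial m gs c) =
    (\<Sum>y\<in>basis m. (cmod (circ_sem m A Q gs (init m) y))\<^sup>2 * prob m A Q R (c y))"
  unfolding prob_def run_trial sum_distrib_left by (rule sum.swap)

lemma prob_Halt: "finite R \<Longrightarrow> prob m A Q R (Halt r) = (if r \<in> R then 1 else 0)"
  by (simp add: prob_def init_def if_distrib[of "\<lambda>x. cmod x ^ 2"] cong: if_cong)

lemma success_prob_eq: "success_prob n m A Q f P = prob m A Q (Sol ` {x\<in>basis n. f x}) P"
  by (simp add: success_prob_def prob_def sum.reindex inj_on_def)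

lemma nosol_prob_eq: "nosol_prob m A Q P = prob m A Q {NoSolution} P"
  by (simp add: nosol_prob_def prob_def)

lemma wf_measure_all:
  "k \<le> m \<Longrightarrow> (\<And>z. z \<in> basis k \<Longrightarrow> wf_prog n m (c z)) \<Longrightarrow> wf_prog n m (measure_all k c)"
  by (induction k arbitrary: c) (auto simp: basis_def)

lemma wf_trial:
  assumes "\<forall>g\<in>set gs. wf_gate n m g" "\<And>y. y \<in> basis m \<Longrightarrow> wf_prog n m (c y)"
  shows "wf_prog n m (trial m gs c)"
proof -
  have "wf_prog n m (foldr Step gs P) \<longleftrightarrow> wf_prog n m P" for P
    using assms(1) by (induction gs) auto
  then show ?thesis
    using assms(2) by (auto simp: trial_def is_unitary_flip intro!: wf_measure_all)
qed

definition num_queries :: "gate list \<Rightarrow> nat" where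
  "num_queries gs = length (filter is_query gs)"

lemma num_queries_simps [simp]:
  "num_queries [] = 0"
  "num_queries (g # gs) = (if is_query g then 1 else 0) + num_queries gs"
  "num_queries (gs @ hs) = num_queries gs + num_queries hs"
  by (simp_all add: num_queries_def)

lemma queries_measure_all:
  "(\<And>z. z \<in> basis k \<Longrightarrow> queries (c z) \<le> B) \<Longrightarrow> queries (measure_all k c) \<le> B"
  by (induction k arbitrary: c) (auto simp: basis_def)

lemma queries_trial:
  assumes "\<And>y. y \<in> basis m \<Longrightarrow> queries (c y) \<le> B"
  shows "queries (trial m gs c) \<le> num_queries gs + B"
proof -
  have "queries (foldr Step gs P) = num_queries gs + queries P" for P
    by (induction gs) auto
  then show ?thesis using assms by (auto simp: trial_def intro: queries_measure_all)
qed

section \<open>Amplitude amplification with votes\<close>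

definition votes :: "nat \<Rightarrow> nat \<Rightarrow> nat \<Rightarrow> gate list" where
  "votes n i j = map (\<lambda>l. Query ([0..<n] @ [n + l])) [i..<j]"

definition score :: "nat \<Rightarrow> nat \<Rightarrow> bool list \<Rightarrow> int" where
  "score n j y = (\<Sum>i<j. if y ! (n + i) then 1 else - 1)"

text \<open>Test \<open>l\<close> counts all of the first \<open>b * Suc l\<close> votes, not just
  the latest \<open>b\<close>. A bad string thus needs a wrong majority in an ever longer sequence,
  which makes its weight geometric in \<open>k\<close>. Ties pass.\<close>

definition pass :: "nat \<Rightarrow> nat \<Rightarrow> nat \<Rightarrow> bool list \<Rightarrow> bool" where
  "pass n b k y \<longleftrightarrow> (\<forall>l\<le>k. 0 \<le> score n (b * Suc l) y)"

text \<open>Each round writes to fresh qubits: the old votes define the flag and must be intact when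
  the next round inverts the circuit. This is where the register of \<open>n + b * Suc K\<close>
  qubits comes from.\<close>

primrec stage :: "nat \<Rightarrow> nat \<Rightarrow> nat \<Rightarrow> nat \<Rightarrow> gate list" where
  "stage n b m 0 = UseA [0..<n] # votes n 0 b"
| "stage n b m (Suc k) =
    amplify m (pass n b k) (stage n b m k) @ votes n (b * Suc k) (b * Suc (Suc k))"

lemma wf_votes: "n + j \<le> m \<Longrightarrow> \<forall>g\<in>set (votes n i j). wf_gate n m g"
  by (auto simp: votes_def)

lemma wf_amplify:
  "\<forall>g\<in>set gs. wf_gate n m g \<Longrightarrow> \<forall>g\<in>set (amplify m F gs). wf_gate n m g"
  by (auto simp: amplify_def is_unitary_diag)

lemma wf_stage: "n + b * Suc k \<le> m \<Longrightarrow> \<forall>g\<in>set (stage n b m k). wf_gate n m g"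
proof (induction k)
  case 0
  then show ?case using wf_votes[of n b m 0] by auto
next
  case (Suc k)
  have "\<forall>g\<in>set (stage n b m k). wf_gate n m g" using Suc by simp
  then show ?case
    using wf_votes[of n "b * Suc (Suc k)" m "b * Suc k"] Suc.prems wf_amplify[of "stage n b m k" n m]
    by (simp add: ball_Un)
qed

lemma num_queries_votes [simp]: "num_queries (votes n i j) = j - i"
  by (simp add: num_queries_def votes_def comp_def)

lemma num_queries_inv_circ [simp]: "num_queries (inv_circ gs) = num_queries gs"
  by (induction gs) (auto simp: inv_circ_def)

text \<open>Amplification runs the previous stage three times and the votes add \<open>b\<close>.
  The recurrence is solved in a form without subtraction and division of natural numbers.\<close>

lemma num_queries_stage: "2 * num_queries (stage n b m k) + b = b * 3 ^ Suc k"
proof (induction k)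
  case (Suc k)
  have "num_queries (stage n b m (Suc k)) = 3 * num_queries (stage n b m k) + b"
    by (simp add: amplify_def)
  then show ?case using Suc by simp
qed simp

text \<open>The amplitude of the vote bits of \<open>y\<close> after \<open>j\<close> of the \<open>T\<close> vote qubits have been filled
  by oracle queries, the others still being zero.\<close>
definition vote_amp :: "nat \<Rightarrow> qop \<Rightarrow> nat \<Rightarrow> nat \<Rightarrow> bool list \<Rightarrow> complex" where
  "vote_amp n Q T j y = (\<Prod>i<T. if i < j then Q (take n y @ [y ! (n + i)]) (take n y @ [False])
     else if y ! (n + i) then 0 else 1)"

lemma vote_amp_Suc:
  assumes j: "j < T" and y: "y \<in> basis (n + T)"
  shows "Q (take n y @ [y ! (n + j)]) (take n y @ [False]) * vote_amp n Q T j (y[n + j := False]) =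
    vote_amp n Q T (Suc j) y"
proof -
  have "(\<Prod>i\<in>{..<T} - {j}. if i < j then Q (take n y @ [y[n + j := False] ! (n + i)]) (take n y @ [False])
        else if y[n + j := False] ! (n + i) then 0 else 1) =
      (\<Prod>i\<in>{..<T} - {j}. if i < Suc j then Q (take n y @ [y ! (n + i)]) (take n y @ [False])
        else if y ! (n + i) then 0 else 1)"
    by (rule prod.cong) auto
  then show ?thesis
    using j y unfolding vote_amp_def
    by (simp add: prod.remove[of "{..<T}" j] basis_def cong: if_cong)
qed

context
  fixes n T :: nat and Q :: qop
  assumes marks: "\<And>x y. x \<in> basis n \<Longrightarrow> y \<in> basis (Suc n) \<Longrightarrow> Q y (x @ [False]) \<noteq> 0 \<Longrightarrow> take n y = x"
begin

text \<open>The oracle is specified only on a zero output qubit. The factor \<open>vote_amp\<close>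
  vanishes when qubit \<open>n + j\<close> is set, so exactly this case contributes;
  \<open>marks\<close> excludes contributions from other strings, and \<open>g\<close> must not look
  at the qubit being written.\<close>

lemma query_vote:
  assumes j: "j < T" and v: "\<And>y. y \<in> basis (n + T) \<Longrightarrow> v y = g y * vote_amp n Q T j y"
    and g: "\<And>y. g (y[n + j := False]) = g y" and y: "y \<in> basis (n + T)"
  shows "gate_sem (n + T) A Q (Query ([0..<n] @ [n + j])) v y = g y * vote_amp n Q T (Suc j) y"
proof -
  define ps where "ps = [0..<n] @ [n + j]"
  define x where "x = take n y"
  have ps: "distinct ps" "set ps \<subseteq> {..<n + T}" "length ps = Suc n"
    using j by (auto simp: ps_def)
  have x: "x \<in> basis n" using y by (simp add: x_def basis_def)
  have r: "map ((!) y) ps = x @ [y ! (n + j)]"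
    using y by (auto simp: ps_def x_def basis_def take_map[symmetric] intro!: nth_equalityI)
  have sT: "v (set_pos y ps (x' @ [True])) = 0" if "x' \<in> basis n" for x'
  proof -
    have "set_pos y ps (x' @ [True]) ! (ps ! n) = (x' @ [True]) ! n"
      using ps y that by (intro nth_set_pos) (auto simp: basis_def)
    then have "set_pos y ps (x' @ [True]) ! (n + j)"
      using that by (simp add: ps_def nth_append basis_def)
    then have "vote_amp n Q T j (set_pos y ps (x' @ [True])) = 0"
      unfolding vote_amp_def using j by (intro prod_zero) auto
    then show ?thesis using v y by simp
  qed
  have sF: "set_pos y ps (x @ [False]) = y[n + j := False]"
  proof (rule set_pos_eqI[OF ps(1,2) y])
    fix i assume "i < length ps"
    then show "y[n + j := False] ! (ps ! i) = (x @ [False]) ! i"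
      using y j by (auto simp: ps_def nth_append x_def basis_def)
  qed (use x y ps in \<open>auto simp: basis_def ps_def\<close>)
  have Q0: "Q (x @ [y ! (n + j)]) (x' @ [False]) = 0" if "x' \<in> basis n" "x' \<noteq> x" for x'
    using marks[of x' "x @ [y ! (n + j)]"] that x by (auto simp: basis_def)
  have "gate_sem (n + T) A Q (Query ps) v y = (\<Sum>x'\<in>basis n.
      Q (x @ [y ! (n + j)]) (x' @ [False]) * v (set_pos y ps (x' @ [False])))"
    by (simp add: apply_on_def ps(3) sum_basis_snoc sT r)
  also have "\<dots> = (\<Sum>x'\<in>basis n. if x' = x
      then Q (x @ [y ! (n + j)]) (x @ [False]) * v (set_pos y ps (x @ [False])) else 0)"
    by (rule sum.cong) (auto simp: Q0)
  also have "\<dots> = Q (x @ [y ! (n + j)]) (x @ [False]) * v (y[n + j := False])"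
    using x by (simp add: sF)
  also have "\<dots> = g y * (Q (x @ [y ! (n + j)]) (x @ [False]) * vote_amp n Q T j (y[n + j := False]))"
    using y g by (simp add: v basis_def)
  also have "\<dots> = g y * vote_amp n Q T (Suc j) y"
    using vote_amp_Suc[OF j y] by (simp add: x_def)
  finally show ?thesis by (simp add: ps_def)
qed

lemma circ_sem_votes:
  assumes "i \<le> j" "j \<le> T" and v: "\<And>y. y \<in> basis (n + T) \<Longrightarrow> v y = g y * vote_amp n Q T i y"
    and g: "\<And>y l. n + i \<le> l \<Longrightarrow> g (y[l := False]) = g y" and "y \<in> basis (n + T)"
  shows "circ_sem (n + T) A Q (votes n i j) v y = g y * vote_amp n Q T j y"
  using assms(1,2,5)
proof (induction j arbitrary: y rule: dec_induct)
  case base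
  then show ?case using v by (simp add: votes_def)
next
  case (step j)
  have "circ_sem (n + T) A Q (votes n i (Suc j)) v y =
      gate_sem (n + T) A Q (Query ([0..<n] @ [n + j])) (circ_sem (n + T) A Q (votes n i j) v) y"
    using step.hyps by (simp add: votes_def)
  also have "\<dots> = g y * vote_amp n Q T (Suc j) y"
    using step by (intro query_vote) (auto simp: g)
  finally show ?case .
qed

end

lemma score_update: "n + j \<le> i \<Longrightarrow> score n j (y[i := c]) = score n j y"
  unfolding score_def by (intro sum.cong) auto

text \<open>Later votes leave earlier tests alone. Hence the amplitude factors that depend on the
  flags pass unchanged through the next block of queries.\<close>

lemma pass_update:
  assumes "n + b * Suc k \<le> i"
  shows "pass n b k (y[i := c]) = pass n b k y"
proof -
  have "score n (b * Suc l) (y[i := c]) = score n (b * Suc l) y" if "l \<le> k" for l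
  proof (rule score_update)
    have "b * Suc l \<le> b * Suc k" using that by (intro mult_le_mono2) simp
    then show "n + b * Suc l \<le> i" using assms by linarith
  qed
  then show ?thesis by (simp add: pass_def)
qed

lemma init_append:
  assumes "x \<in> basis n" "v \<in> basis T"
  shows "init (n + T) (x @ v) =
    (if x = replicate n False then 1 else 0) * (if v = replicate T False then 1 else 0)"
  using assms by (auto simp: init_def replicate_add basis_def)

lemma vote_amp_0:
  assumes "x \<in> basis n" "v \<in> basis T"
  shows "vote_amp n Q T 0 (x @ v) = (if v = replicate T False then 1 else 0)"
proof -
  have "v = replicate T False \<longleftrightarrow> (\<forall>i<T. \<not> v ! i)"
    using assms(2) by (auto simp: basis_def list_eq_iff_nth_eq)
  then show ?thesis
    using assms by (auto simp: vote_amp_def basis_def nth_append)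
qed

lemma gate_sem_prepare:
  assumes y: "y \<in> basis (n + T)"
  shows "gate_sem (n + T) A Q (UseA [0..<n]) (init (n + T)) y =
    amp n A (take n y) * vote_amp n Q' T 0 y"
proof -
  define x v where "x = take n y" and "v = drop n y"
  have xv: "y = x @ v" "x \<in> basis n" "v \<in> basis T" using y by (auto simp: x_def v_def basis_def)
  have "set_pos y [0..<n] z = z @ v" if "z \<in> basis n" for z
    by (rule set_pos_eqI[of _ "n + T"]) (use that xv in \<open>auto simp: basis_def nth_append\<close>)
  moreover have "map ((!) y) [0..<n] = x"
    using xv by (auto simp: basis_def nth_append intro!: nth_equalityI)
  ultimately have "gate_sem (n + T) A Q (UseA [0..<n]) (init (n + T)) y =
      (\<Sum>z\<in>basis n. A x z * init (n + T) (z @ v))"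
    by (simp add: apply_on_def)
  also have "\<dots> = amp n A x * vote_amp n Q' T 0 y"
    using xv by (simp add: init_append vote_amp_0 amp_def if_distrib[of "\<lambda>c. _ * c"] cong: if_cong)
  finally show ?thesis by (simp add: x_def)
qed

definition flag_weight :: "nat \<Rightarrow> nat \<Rightarrow> nat \<Rightarrow> qop \<Rightarrow> qop \<Rightarrow> nat \<Rightarrow> real" where
  "flag_weight n b m A Q k = (\<Sum>y\<in>{y\<in>basis m. pass n b k y}.
    (cmod (circ_sem m A Q (stage n b m k) (init m) y))\<^sup>2)"

text \<open>Once a state fails a test it stays unflagged, so every round multiplies its amplitude by a
  factor that depends only on the outcome of the tests.\<close>
lemma circ_sem_stage:
  assumes A: "is_unitary n A" and Q: "is_unitary (Suc n) Q"
    and marks: "\<And>x y. x \<in> basis n \<Longrightarrow> y \<in> basis (Suc n) \<Longrightarrow> Q y (x @ [False]) \<noteq> 0 \<Longrightarrow> take n y = x"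
    and "b * Suc k \<le> T" "y \<in> basis (n + T)"
  shows "circ_sem (n + T) A Q (stage n b (n + T) k) (init (n + T)) y =
    of_real (\<Prod>l<k. if pass n b l y then 4 * flag_weight n b (n + T) A Q l - 3
      else 4 * flag_weight n b (n + T) A Q l - 1) * amp n A (take n y) * vote_amp n Q T (b * Suc k) y"
  using assms(4,5)
proof (induction k arbitrary: y)
  case 0
  have "circ_sem (n + T) A Q (votes n 0 b)
      (gate_sem (n + T) A Q (UseA [0..<n]) (init (n + T))) y = amp n A (take n y) * vote_amp n Q T b y"
    using 0 by (intro circ_sem_votes gate_sem_prepare marks) auto
  then show ?case using 0 by simp
next
  case (Suc k)
  let ?m = "n + T"
  let ?s = "flag_weight n b ?m A Q"
  let ?c = "\<lambda>l y. if pass n b l y then 4 * ?s l - 3 else 4 * ?s l - 1"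
  have wf: "\<forall>g\<in>set (stage n b ?m k). wf_gate n ?m g"
    using Suc.prems by (intro wf_stage) simp
  have amp: "circ_sem ?m A Q (amplify ?m (pass n b k) (stage n b ?m k)) (init ?m) y =
      (of_real (\<Prod>l<Suc k. ?c l y) * amp n A (take n y)) * vote_amp n Q T (b * Suc k) y"
    if "y \<in> basis ?m" for y
    unfolding circ_sem_amplify[OF A Q wf that] flag_weight_def[symmetric]
    using Suc.IH[OF _ that] Suc.prems by simp
  have upd: "of_real (\<Prod>j<Suc k. ?c j (y[l := False])) * amp n A (take n (y[l := False])) =
      complex_of_real (\<Prod>j<Suc k. ?c j y) * amp n A (take n y)" if l: "n + b * Suc k \<le> l" for l y
  proof -
    have "pass n b j (y[l := False]) = pass n b j y" if "j < Suc k" for j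
    proof (rule pass_update)
      have "b * Suc j \<le> b * Suc k" using that by (intro mult_le_mono2) simp
      then show "n + b * Suc j \<le> l" using l by linarith
    qed
    then have "(\<Prod>j<Suc k. ?c j (y[l := False])) = (\<Prod>j<Suc k. ?c j y)"
      by (intro prod.cong) auto
    then show ?thesis using l by simp
  qed
  have "circ_sem ?m A Q (stage n b ?m (Suc k)) (init ?m) y =
      circ_sem ?m A Q (votes n (b * Suc k) (b * Suc (Suc k)))
        (circ_sem ?m A Q (amplify ?m (pass n b k) (stage n b ?m k)) (init ?m)) y"
    by simp
  also have "\<dots> = (of_real (\<Prod>l<Suc k. ?c l y) * amp n A (take n y)) * vote_amp n Q T (b * Suc (Suc k)) y"
    using Suc.prems by (intro circ_sem_votes[OF marks _ _ amp upd]) auto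
  finally show ?case .
qed

section \<open>Votes as independent trials\<close>

text \<open>Distributivity, read as independence of the vote bits.\<close>

lemma sum_basis_prod:
  fixes u :: "nat \<Rightarrow> bool \<Rightarrow> real"
  shows "(\<Sum>v\<in>basis T. \<Prod>i<T. u i (v ! i)) = (\<Prod>i<T. u i False + u i True)"
proof (induction T)
  case (Suc T)
  have "(\<Prod>i<Suc T. u i ((v @ [c]) ! i)) = (\<Prod>i<T. u i (v ! i)) * u T c" if "v \<in> basis T" for v c
    using that by (simp add: basis_def nth_append)
  then have "(\<Sum>v\<in>basis (Suc T). \<Prod>i<Suc T. u i (v ! i)) =
      (\<Sum>v\<in>basis T. (\<Prod>i<T. u i (v ! i)) * (u T False + u T True))"
    unfolding sum_basis_snoc by (intro sum.cong) (simp_all add: distrib_left)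
  then show ?case by (simp add: Suc sum_distrib_right[symmetric])
qed simp

lemma sum_UN_le:
  fixes w :: "'a \<Rightarrow> real"
  assumes "finite I" "\<And>i. i \<in> I \<Longrightarrow> finite (W i)" "\<And>v. 0 \<le> w v"
  shows "(\<Sum>v\<in>(\<Union>i\<in>I. W i). w v) \<le> (\<Sum>i\<in>I. \<Sum>v\<in>W i. w v)"
  using assms(1,2)
proof (induction I rule: finite_induct)
  case (insert i I)
  have "sum w (W i \<union> (\<Union>i\<in>I. W i)) \<le> sum w (W i) + sum w (\<Union>i\<in>I. W i)"
    using insert assms(3) by (subst sum.union_inter[symmetric]) (auto intro: sum_nonneg)
  then show ?case using insert by simp
qed simp

lemma prod_powr_sum:
  fixes t :: real and P :: "nat \<Rightarrow> bool"
  assumes "t > 0"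
  shows "(\<Prod>i<j. if P i then t else 1 / t) = t powr (\<Sum>i<j. if P i then 1 else - 1)"
  using assms by (induction j) (auto simp: powr_add powr_minus_divide)

definition vote_prob :: "nat \<Rightarrow> qop \<Rightarrow> nat \<Rightarrow> nat \<Rightarrow> bool list \<Rightarrow> real" where
  "vote_prob n Q T j y = (cmod (vote_amp n Q T j y))\<^sup>2"

definition pass_prob :: "nat \<Rightarrow> nat \<Rightarrow> nat \<Rightarrow> qop \<Rightarrow> nat \<Rightarrow> bool list \<Rightarrow> real" where
  "pass_prob n b T Q k x = (\<Sum>v\<in>{v\<in>basis T. pass n b k (x @ v)}. vote_prob n Q T (b * Suc k) (x @ v))"

lemma score_append: "x \<in> basis n \<Longrightarrow> score n j (x @ v) = (\<Sum>i<j. if v ! i then 1 else - 1)"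
  by (simp add: score_def basis_def nth_append)

lemma vote_prob_nonneg: "0 \<le> vote_prob n Q T j y"
  by (simp add: vote_prob_def)

lemma vote_prob_append:
  assumes "x \<in> basis n"
  shows "vote_prob n Q T j (x @ v) = (\<Prod>i<T. if i < j then (cmod (Q (x @ [v ! i]) (x @ [False])))\<^sup>2
    else if v ! i then 0 else 1)"
  using assms unfolding vote_prob_def vote_amp_def prod_norm[symmetric] prod_power_distrib
  by (intro prod.cong) (auto simp: basis_def nth_append)

lemma oracle_marks:
  assumes "bounded_error_oracle n p f Q" "x \<in> basis n" "y \<in> basis (Suc n)" "Q y (x @ [False]) \<noteq> 0"
  shows "take n y = x"
  using assms by (auto simp: bounded_error_oracle_def)

text \<open>Column \<open>x @ [False]\<close> has norm one by unitarity, and outside the two rows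
  that keep \<open>x\<close> its entries vanish.\<close>

lemma oracle_total:
  assumes Q: "bounded_error_oracle n p f Q" and x: "x \<in> basis n"
  shows "(cmod (Q (x @ [False]) (x @ [False])))\<^sup>2 + (cmod (Q (x @ [True]) (x @ [False])))\<^sup>2 = 1"
proof -
  let ?q = "\<lambda>y. (cmod (Q y (x @ [False])))\<^sup>2"
  have "x @ [False] \<in> basis (Suc n)" using x by (simp add: basis_def)
  then have "(\<Sum>y\<in>basis (Suc n). cnj (Q y (x @ [False])) * Q y (x @ [False])) = 1"
    using Q by (simp add: bounded_error_oracle_def is_unitary_def)
  then have "complex_of_real (\<Sum>y\<in>basis (Suc n). ?q y) = of_real 1"
    by (simp add: cnj_mult_self)
  then have "1 = (\<Sum>y\<in>basis (Suc n). ?q y)" unfolding of_real_eq_iff by simp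
  also have "\<dots> = (\<Sum>x'\<in>basis n. ?q (x' @ [False]) + ?q (x' @ [True]))"
    by (rule sum_basis_snoc)
  also have "\<dots> = (\<Sum>x'\<in>basis n. if x' = x then ?q (x @ [False]) + ?q (x @ [True]) else 0)"
  proof (rule sum.cong)
    fix x' assume x': "x' \<in> basis n"
    have "Q (x' @ [c]) (x @ [False]) = 0" if "x' \<noteq> x" for c
      using oracle_marks[OF Q x, of "x' @ [c]"] x' that by (auto simp: basis_def)
    then show "?q (x' @ [False]) + ?q (x' @ [True]) =
        (if x' = x then ?q (x @ [False]) + ?q (x @ [True]) else 0)" by auto
  qed simp
  also have "\<dots> = ?q (x @ [False]) + ?q (x @ [True])" using x by simp
  finally show ?thesis by simp
qed

context
  fixes n :: nat and p :: real and f :: "bool list \<Rightarrow> bool" and Q :: qop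
  assumes Q: "bounded_error_oracle n p f Q" and p: "1/2 < p" "p < 1"
begin

lemma sum_vote_prob:
  assumes x: "x \<in> basis n"
  shows "(\<Sum>v\<in>basis T. vote_prob n Q T j (x @ v)) = 1"
  unfolding vote_prob_append[OF x]
  by (subst sum_basis_prod[where u = "\<lambda>i c. if i < j then (cmod (Q (x @ [c]) (x @ [False])))\<^sup>2
      else if c then 0 else 1"]) (simp add: oracle_total[OF Q x] if_distrib cong: if_cong)

text \<open>Chernoff bound with the optimal exponent \<open>t = sqrt (p / (1 - p))\<close>.\<close>
lemma wrong_majority:
  assumes x: "x \<in> basis n" and j: "j' \<le> j" "j \<le> T"
  shows "(\<Sum>v\<in>{v\<in>basis T. 0 \<le> (\<Sum>i<j'. if v ! i \<noteq> f x then 1 else - 1 :: int)}.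
    vote_prob n Q T j (x @ v)) \<le> (2 * sqrt (p * (1 - p))) ^ j'"
proof -
  define t where "t = sqrt (p / (1 - p))"
  define B where "B = 2 * sqrt (p * (1 - p))"
  define w where "w c = (cmod (Q (x @ [c]) (x @ [False])))\<^sup>2" for c
  define \<tau> where "\<tau> c = (if c \<noteq> f x then t else 1 / t)" for c
  \<comment> \<open>The weight of one vote, multiplied for the first \<open>j'\<close> votes by the
    Chernoff factor \<open>t\<close> if the vote is wrong and \<open>1 / t\<close> if it is
    right.\<close>
  define u where "u i c = (if i < j then w c else if c then 0 else 1) * (if i < j' then \<tau> c else 1)" for i c
  have t1: "1 \<le> t" using p by (simp add: t_def)
  have u0: "0 \<le> u i c" for i c using t1 by (simp add: u_def \<tau>_def w_def)
  have w1: "w False + w True = 1" using oracle_total[OF Q x] by (simp add: w_def)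
  have wf: "p \<le> w (f x)" using Q x by (simp add: bounded_error_oracle_def w_def)
  have wsum: "w (f x) + w (\<not> f x) = 1" using w1 by (cases "f x") auto
  \<comment> \<open>At the optimal \<open>t\<close> both halves of the expected factor are equal,
    which gives \<open>B\<close> its closed form.\<close>
  have sq: "p / t = sqrt (p * (1 - p))" "(1 - p) * t = sqrt (p * (1 - p))"
  proof -
    define a d where "a = sqrt p" and "d = sqrt (1 - p)"
    have "0 < a" "0 < d" "p = a * a" "1 - p = d * d" using p by (simp_all add: a_def d_def)
    moreover have "t = a / d" "sqrt (p * (1 - p)) = a * d"
      by (simp_all add: t_def a_def d_def real_sqrt_divide real_sqrt_mult)
    ultimately show "p / t = sqrt (p * (1 - p))" "(1 - p) * t = sqrt (p * (1 - p))" by simp_all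
  qed
  have B: "B = p / t + (1 - p) * t" by (simp add: sq B_def)
  have "u i False + u i True \<le> (if i < j' then B else 1)" for i
  proof (cases "i < j'")
    case True
    then have "u i False + u i True = w (f x) / t + w (\<not> f x) * t"
      using j by (cases "f x") (auto simp: u_def \<tau>_def)
    also have "\<dots> = (1 - w (\<not> f x)) / t + w (\<not> f x) * t"
      using wsum by (simp add: algebra_simps)
    also have "\<dots> = 1 / t + w (\<not> f x) * (t - 1 / t)" by (simp add: algebra_simps diff_divide_distrib)
    \<comment> \<open>The expression is linear in the error probability with slope
      \<open>t - 1 / t\<close>, nonnegative as \<open>1 \<le> t\<close>; so the largest error
      probability \<open>1 - p\<close> is the worst case.\<close>
    also have "\<dots> \<le> 1 / t + (1 - p) * (t - 1 / t)"
    proof -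
      have "1 / t \<le> 1" using t1 by simp
      then have "0 \<le> t - 1 / t" using t1 by linarith
      then show ?thesis using wf wsum by (intro add_left_mono mult_right_mono) auto
    qed
    also have "\<dots> = B" by (simp add: B algebra_simps diff_divide_distrib)
    finally show ?thesis using True by simp
  next
    case False
    then show ?thesis using w1 by (simp add: u_def)
  qed
  then have le: "(\<Prod>i<T. u i False + u i True) \<le> (\<Prod>i<T. if i < j' then B else 1)"
    using u0 by (intro prod_mono) (auto intro: add_nonneg_nonneg)
  have "{..<T} \<inter> {i. i < j'} = {..<j'}" using j by auto
  then have B': "(\<Prod>i<T. if i < j' then B else 1) = B ^ j'"
    by (simp add: prod.If_cases)
  \<comment> \<open>When wrong votes are at least as many as right ones, the product of the factors
    is a nonnegative power of \<open>t\<close>, hence at least one, and may be inserted.\<close>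
  have "vote_prob n Q T j (x @ v) \<le> (\<Prod>i<T. u i (v ! i))"
    if v: "0 \<le> (\<Sum>i<j'. if v ! i \<noteq> f x then 1 else - 1 :: int)" for v
  proof -
    have "real_of_int (\<Sum>i<j'. if v ! i \<noteq> f x then 1 else - 1) = (\<Sum>i<j'. if v ! i \<noteq> f x then 1 else - 1)"
      unfolding of_int_sum by (intro sum.cong) auto
    moreover have "0 \<le> real_of_int (\<Sum>i<j'. if v ! i \<noteq> f x then 1 else - 1)"
      using v unfolding of_int_0_le_iff .
    ultimately have "1 \<le> (\<Prod>i<j'. \<tau> (v ! i))"
      using t1 by (simp only: \<tau>_def prod_powr_sum ge_one_powr_ge_zero)
    also have "\<dots> = (\<Prod>i<T. if i < j' then \<tau> (v ! i) else 1)"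
      using \<open>{..<T} \<inter> {i. i < j'} = {..<j'}\<close> by (simp add: prod.If_cases)
    finally have "vote_prob n Q T j (x @ v) * 1 \<le>
        vote_prob n Q T j (x @ v) * (\<Prod>i<T. if i < j' then \<tau> (v ! i) else 1)"
      using vote_prob_nonneg by (intro mult_left_mono)
    then show ?thesis
      by (simp add: vote_prob_append[OF x] u_def w_def prod.distrib cong: if_cong)
  qed
  then have "(\<Sum>v\<in>{v\<in>basis T. 0 \<le> (\<Sum>i<j'. if v ! i \<noteq> f x then 1 else - 1 :: int)}.
      vote_prob n Q T j (x @ v)) \<le>
    (\<Sum>v\<in>{v\<in>basis T. 0 \<le> (\<Sum>i<j'. if v ! i \<noteq> f x then 1 else - 1 :: int)}. \<Prod>i<T. u i (v ! i))"
    by (intro sum_mono) auto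
  also have "\<dots> \<le> (\<Sum>v\<in>basis T. \<Prod>i<T. u i (v ! i))"
    using u0 by (intro sum_mono2) (auto intro: prod_nonneg)
  also have "\<dots> \<le> B ^ j'" using le B' by (simp add: sum_basis_prod)
  finally show ?thesis by (simp add: B_def)
qed

lemma pass_prob_le_1: "x \<in> basis n \<Longrightarrow> pass_prob n b T Q k x \<le> 1"
  unfolding pass_prob_def sum_vote_prob[symmetric, of x T "b * Suc k"]
  by (intro sum_mono2) (auto simp: vote_prob_nonneg)

text \<open>The last test alone gives the bound: passing it takes a wrong majority among all
  \<open>b * Suc k\<close> votes.\<close>

lemma pass_prob_bad:
  assumes x: "x \<in> basis n" "\<not> f x" and "b * Suc k \<le> T"
  shows "pass_prob n b T Q k x \<le> ((2 * sqrt (p * (1 - p))) ^ b) ^ Suc k"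
proof -
  have "pass_prob n b T Q k x \<le> (\<Sum>v\<in>{v\<in>basis T. 0 \<le> (\<Sum>i<b * Suc k. if v ! i \<noteq> f x then 1 else - 1 :: int)}.
      vote_prob n Q T (b * Suc k) (x @ v))"
    unfolding pass_prob_def using x
    by (intro sum_mono2) (auto simp: vote_prob_nonneg pass_def score_append)
  also have "\<dots> \<le> (2 * sqrt (p * (1 - p))) ^ (b * Suc k)"
    using assms by (intro wrong_majority) auto
  finally show ?thesis unfolding power_mult .
qed

text \<open>Union bound over the tests at which a good string can lose its flag.\<close>

lemma pass_prob_good:
  assumes x: "x \<in> basis n" "f x" and T: "b * Suc k \<le> T"
  shows "1 - (\<Sum>l\<le>k. ((2 * sqrt (p * (1 - p))) ^ b) ^ Suc l) \<le> pass_prob n b T Q k x"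
proof -
  let ?w = "\<lambda>v. vote_prob n Q T (b * Suc k) (x @ v)"
  let ?W = "\<lambda>l. {v\<in>basis T. 0 \<le> (\<Sum>i<b * Suc l. if v ! i \<noteq> f x then 1 else - 1 :: int)}"
  have sub: "{v\<in>basis T. \<not> pass n b k (x @ v)} \<subseteq> (\<Union>l\<in>{..k}. ?W l)"
  proof
    fix v assume "v \<in> {v\<in>basis T. \<not> pass n b k (x @ v)}"
    then obtain l where l: "v \<in> basis T" "l \<le> k" "score n (b * Suc l) (x @ v) < 0"
      by (auto simp: pass_def not_le)
    have "(\<Sum>i<b * Suc l. if v ! i \<noteq> f x then 1 else - 1 :: int) = - score n (b * Suc l) (x @ v)"
      unfolding score_append[OF x(1)] sum_negf[symmetric] using x by (intro sum.cong) auto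
    then have "v \<in> ?W l" using l by simp
    then show "v \<in> (\<Union>l\<in>{..k}. ?W l)" using l by blast
  qed
  have "(\<Sum>v\<in>{v\<in>basis T. \<not> pass n b k (x @ v)}. ?w v) \<le> (\<Sum>v\<in>(\<Union>l\<in>{..k}. ?W l). ?w v)"
    using sub by (intro sum_mono2) (auto simp: vote_prob_nonneg)
  also have "\<dots> \<le> (\<Sum>l\<in>{..k}. \<Sum>v\<in>?W l. ?w v)"
    by (intro sum_UN_le) (auto simp: vote_prob_nonneg)
  also have "\<dots> \<le> (\<Sum>l\<le>k. (2 * sqrt (p * (1 - p))) ^ (b * Suc l))"
    using x T by (intro sum_mono wrong_majority) auto
  finally have "(\<Sum>v\<in>{v\<in>basis T. \<not> pass n b k (x @ v)}. ?w v) \<le>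
      (\<Sum>l\<le>k. ((2 * sqrt (p * (1 - p))) ^ b) ^ Suc l)"
    unfolding power_mult .
  moreover have "1 = pass_prob n b T Q k x + (\<Sum>v\<in>{v\<in>basis T. \<not> pass n b k (x @ v)}. ?w v)"
  proof -
    have "basis T = {v\<in>basis T. pass n b k (x @ v)} \<union> {v\<in>basis T. \<not> pass n b k (x @ v)}" by auto
    then have "(\<Sum>v\<in>basis T. ?w v) =
        sum ?w ({v\<in>basis T. pass n b k (x @ v)} \<union> {v\<in>basis T. \<not> pass n b k (x @ v)})" by simp
    also have "\<dots> = pass_prob n b T Q k x + (\<Sum>v\<in>{v\<in>basis T. \<not> pass n b k (x @ v)}. ?w v)"
      unfolding pass_prob_def by (intro sum.union_disjoint) auto
    finally show ?thesis by (simp add: sum_vote_prob x)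
  qed
  ultimately show ?thesis by linarith
qed

end

section \<open>Growth of the flagged weight\<close>

definition cand_weight :: "nat \<Rightarrow> nat \<Rightarrow> nat \<Rightarrow> qop \<Rightarrow> qop \<Rightarrow> nat \<Rightarrow> bool list \<Rightarrow> real" where
  "cand_weight n b T A Q k x = (\<Sum>v\<in>{v\<in>basis T. pass n b k (x @ v)}.
    (cmod (circ_sem (n + T) A Q (stage n b (n + T) k) (init (n + T)) (x @ v)))\<^sup>2)"

lemma cand_weight_nonneg: "0 \<le> cand_weight n b T A Q k x"
  by (simp add: cand_weight_def sum_nonneg)

lemma flag_weight_eq: "flag_weight n b (n + T) A Q k = (\<Sum>x\<in>basis n. cand_weight n b T A Q k x)"
  unfolding flag_weight_def cand_weight_def
  by (simp add: sum.inter_filter sum_basis_append)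

lemma sum_circ_sem_init:
  assumes "is_unitary n A" "is_unitary (Suc n) Q" "\<forall>g\<in>set gs. wf_gate n m g"
  shows "(\<Sum>y\<in>basis m. (cmod (circ_sem m A Q gs (init m) y))\<^sup>2) = 1"
  unfolding circ_sem_isometry[OF assms]
  by (simp add: init_def if_distrib[of "\<lambda>x. cmod x ^ 2"] cong: if_cong)

lemma flag_weight_bounds:
  assumes "is_unitary n A" "is_unitary (Suc n) Q" "b * Suc k \<le> T"
  shows "0 \<le> flag_weight n b (n + T) A Q k" "flag_weight n b (n + T) A Q k \<le> 1"
proof -
  have wf: "\<forall>g\<in>set (stage n b (n + T) k). wf_gate n (n + T) g"
    using assms by (intro wf_stage) simp
  show "0 \<le> flag_weight n b (n + T) A Q k" by (simp add: flag_weight_def sum_nonneg)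
  show "flag_weight n b (n + T) A Q k \<le> 1"
    unfolding flag_weight_def sum_circ_sem_init[OF assms(1,2) wf, symmetric]
    by (intro sum_mono2) auto
qed

text \<open>A string flagged after round \<open>k\<close> was flagged in all earlier rounds, so all
  flagged amplitudes share the same growth factors, and squaring removes their signs. Amplification
  therefore never distorts the ratios within the flagged part.\<close>

lemma cand_weight_eq:
  assumes A: "is_unitary n A" and Q: "bounded_error_oracle n p f Q"
    and "b * Suc k \<le> T" "x \<in> basis n"
  shows "cand_weight n b T A Q k x =
    (\<Prod>l<k. 3 - 4 * flag_weight n b (n + T) A Q l)\<^sup>2 * ((cmod (amp n A x))\<^sup>2 * pass_prob n b T Q k x)"
proof -
  let ?s = "flag_weight n b (n + T) A Q"
  have U: "is_unitary (Suc n) Q" using Q by (simp add: bounded_error_oracle_def)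
  have "(cmod (circ_sem (n + T) A Q (stage n b (n + T) k) (init (n + T)) (x @ v)))\<^sup>2 =
      (\<Prod>l<k. 3 - 4 * ?s l)\<^sup>2 * ((cmod (amp n A x))\<^sup>2 * vote_prob n Q T (b * Suc k) (x @ v))"
    if v: "v \<in> basis T" "pass n b k (x @ v)" for v
  proof -
    have "pass n b l (x @ v)" if "l < k" for l using v that by (simp add: pass_def)
    then have "(\<Prod>l<k. if pass n b l (x @ v) then 4 * ?s l - 3 else 4 * ?s l - 1)\<^sup>2 =
        (\<Prod>l<k. (4 * ?s l - 3)\<^sup>2)"
      unfolding prod_power_distrib by (intro prod.cong) auto
    also have "\<dots> = (\<Prod>l<k. 3 - 4 * ?s l)\<^sup>2"
      unfolding prod_power_distrib by (intro prod.cong) (auto simp: power2_commute)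
    finally have 1: "(\<Prod>l<k. if pass n b l (x @ v) then 4 * ?s l - 3 else 4 * ?s l - 1)\<^sup>2 =
        (\<Prod>l<k. 3 - 4 * ?s l)\<^sup>2" .
    have "x @ v \<in> basis (n + T)" "take n (x @ v) = x" using v assms by (auto simp: basis_def)
    then show ?thesis
      using circ_sem_stage[OF A U oracle_marks[OF Q] assms(3), of "x @ v"]
      by (simp add: norm_mult power_mult_distrib 1 vote_prob_def del: of_real_prod)
  qed
  then show ?thesis
    unfolding cand_weight_def pass_prob_def sum_distrib_left by (intro sum.cong) auto
qed

lemma sum_power_le_2:
  fixes r :: real
  assumes "0 \<le> r" "r \<le> 1/2"
  shows "(\<Sum>l<k. r ^ l) \<le> 2"
proof -
  have "(\<Sum>l<k. r ^ l) = (1 - r ^ k) / (1 - r)" using assms by (simp add: sum_gp_strict)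
  also have "\<dots> \<le> 1 / (1 - r)" using assms by (intro divide_right_mono) auto
  also have "\<dots> \<le> 2" using assms by (simp add: field_simps)
  finally show ?thesis .
qed

text \<open>As long as the flagged weight \<open>s\<close> is small, \<open>c\<close> grows by a factor close to three per round;
  the good weight then dominates a geometric series, so the total loss against \<open>3 ^ k\<close> is bounded.\<close>
lemma amplification_sequence:
  fixes c s g h :: "nat \<Rightarrow> real" and G \<beta> lam :: real
  assumes c: "\<And>k. c k = (\<Prod>l<k. 3 - 4 * s l)"
    and s: "\<And>k. k \<le> K \<Longrightarrow> s k = (c k)\<^sup>2 * g k + (c k)\<^sup>2 * h k"
    and s01: "\<And>k. k \<le> K \<Longrightarrow> 0 \<le> s k" "\<And>k. k \<le> K \<Longrightarrow> s k \<le> 1"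
    and h: "\<And>k. k \<le> K \<Longrightarrow> 0 \<le> h k" "\<And>k. k \<le> K \<Longrightarrow> h k \<le> \<beta> ^ Suc k"
    and \<beta>: "0 \<le> \<beta>" "\<beta> \<le> 1/1000"
  shows "(\<Sum>k\<le>K. (c k)\<^sup>2 * h k) \<le> 2 * \<beta>"
    and "\<lbrakk>\<And>k. k \<le> K \<Longrightarrow> G / 2 \<le> g k; \<And>k. k \<le> K \<Longrightarrow> g k \<le> G; 0 < lam; lam \<le> G; 1 \<le> 9 ^ K * lam\<rbrakk>
      \<Longrightarrow> \<exists>k\<le>K. 1/16 \<le> s k"
proof -
  have c0: "c 0 = 1" and cS: "c (Suc k) = c k * (3 - 4 * s k)" for k by (simp_all add: c)
  have c9: "(c k)\<^sup>2 \<le> 9 ^ k" if "k \<le> K" for k using that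
  proof (induction k)
    case (Suc k)
    have "\<bar>3 - 4 * s k\<bar> \<le> 3" using s01[of k] Suc.prems by auto
    then have "(3 - 4 * s k)\<^sup>2 \<le> 9" using abs_le_square_iff[of "3 - 4 * s k" 3] by simp
    then have "(c k)\<^sup>2 * (3 - 4 * s k)\<^sup>2 \<le> 9 ^ k * 9" using Suc by (intro mult_mono) auto
    then show ?case by (simp add: cS power_mult_distrib)
  qed (simp add: c0)
  \<comment> \<open>A round gains at most the factor 9 in weight and loses \<open>\<beta>\<close>,
    which leaves a geometric series with ratio \<open>9 * \<beta>\<close>.\<close>
  have hb: "(c k)\<^sup>2 * h k \<le> \<beta> * (9 * \<beta>) ^ k" if "k \<le> K" for k
  proof -
    have "(c k)\<^sup>2 * h k \<le> 9 ^ k * \<beta> ^ Suc k"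
      using c9[OF that] h[OF that] by (intro mult_mono) auto
    then show ?thesis by (simp add: power_mult_distrib algebra_simps)
  qed
  have hsum: "(\<Sum>k<j. (c k)\<^sup>2 * h k) \<le> 2 * \<beta>" if "j \<le> Suc K" for j
  proof -
    have "(\<Sum>k<j. (c k)\<^sup>2 * h k) \<le> (\<Sum>k<j. \<beta> * (9 * \<beta>) ^ k)"
      using that by (intro sum_mono hb) auto
    also have "\<dots> \<le> \<beta> * 2"
      unfolding sum_distrib_left[symmetric] using \<beta> by (intro mult_left_mono sum_power_le_2) auto
    finally show ?thesis by simp
  qed
  show "(\<Sum>k\<le>K. (c k)\<^sup>2 * h k) \<le> 2 * \<beta>"
    using hsum[of "Suc K"] unfolding lessThan_Suc_atMost by simp
  assume g: "\<And>k. k \<le> K \<Longrightarrow> G / 2 \<le> g k" "\<And>k. k \<le> K \<Longrightarrow> g k \<le> G"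
    and lam: "0 < lam" "lam \<le> G" "1 \<le> 9 ^ K * lam"
  show "\<exists>k\<le>K. 1/16 \<le> s k"
  proof (rule ccontr)
    assume "\<not> ?thesis"
    then have small: "s k < 1/16" if "k \<le> K" for k using that by force
    \<comment> \<open>\<open>u\<close> follows the good weight with the constant \<open>G\<close> in
      place of \<open>g k\<close>, which is between \<open>G / 2\<close> and \<open>G\<close>. Since
      \<open>s k\<close> is below 1/16, \<open>u\<close> stays at most 1/8, and the growth factor
      \<open>3 - 4 * s k\<close> exceeds 2, so \<open>u\<close> quadruples and dominates the sum of
      its earlier values.\<close>
    define u where "u k = (c k)\<^sup>2 * G" for k
    have u0: "0 \<le> u k" for k using lam by (simp add: u_def)
    have u_le: "u k \<le> 1/8" if "k \<le> K" for k
    proof -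
      have "(c k)\<^sup>2 * (G / 2) \<le> (c k)\<^sup>2 * g k" using g that by (intro mult_left_mono) auto
      moreover have "0 \<le> (c k)\<^sup>2 * h k" using h that by simp
      ultimately show ?thesis using s[OF that] small[OF that] by (simp add: u_def)
    qed
    have u4: "4 * u k \<le> u (Suc k)" if "k \<le> K" for k
    proof -
      have "2\<^sup>2 \<le> (3 - 4 * s k)\<^sup>2" using small[OF that] by (intro power_mono) auto
      then have "4 * u k \<le> (3 - 4 * s k)\<^sup>2 * u k" using u0 by (intro mult_right_mono) auto
      then show ?thesis by (simp add: u_def cS power_mult_distrib mult_ac)
    qed
    have usum: "(\<Sum>l<k. u l) \<le> u k / 3" if "k \<le> K" for k using that
    proof (induction k)
      case (Suc k)
      then show ?case using u4[of k] by simp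
    qed (use u0 in simp)
    \<comment> \<open>The product of the factors \<open>1 - 4/3 * s l\<close> is at least one minus
      the sum of the losses.\<close>
    have c3: "3 ^ k * (1 - 4/3 * (\<Sum>l<k. s l)) \<le> c k" if "k \<le> K" for k using that
    proof (induction k)
      case (Suc k)
      let ?S = "\<Sum>l<k. s l"
      have S0: "0 \<le> ?S" using s01 Suc.prems by (intro sum_nonneg) auto
      have sk: "0 \<le> s k" "s k < 1/16" using s01 small Suc.prems by auto
      have "3 ^ Suc k * (1 - 4/3 * (?S + s k)) \<le> 3 ^ Suc k * ((1 - 4/3 * ?S) * (1 - 4/3 * s k))"
        using S0 sk by (intro mult_left_mono) (auto simp: algebra_simps)
      also have "\<dots> = (3 ^ k * (1 - 4/3 * ?S)) * (3 - 4 * s k)" by (simp add: algebra_simps)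
      also have "\<dots> \<le> c k * (3 - 4 * s k)"
        using Suc sk by (intro mult_right_mono) auto
      finally show ?case by (simp add: cS)
    qed (simp add: c0)
    have "(\<Sum>l<K. s l) \<le> (\<Sum>l<K. u l + (c l)\<^sup>2 * h l)"
      using s g by (intro sum_mono) (auto simp: u_def intro!: mult_left_mono)
    also have "\<dots> \<le> u K / 3 + 2 * \<beta>"
      unfolding sum.distrib using usum[of K] hsum[of K] by simp
    \<comment> \<open>From 1/24 for the good part and 1/500 for the bad part. The loss against
      \<open>3 ^ K\<close> is then below one tenth.\<close>
    also have "\<dots> \<le> 1/20" using u_le[of K] \<beta> by simp
    finally have "9/10 \<le> 1 - 4/3 * (\<Sum>l<K. s l)" by simp
    then have "3 ^ K * (9/10) \<le> 3 ^ K * (1 - 4/3 * (\<Sum>l<K. s l))" by (intro mult_left_mono) auto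
    also have "\<dots> \<le> c K" using c3 by simp
    finally have "(3 ^ K * (9/10))\<^sup>2 \<le> (c K)\<^sup>2" by (intro power_mono) auto
    moreover have "(3 ^ K)\<^sup>2 = (9::real) ^ K" by (simp add: power2_eq_square flip: power_mult_distrib)
    ultimately have "9 ^ K * (81/100) \<le> (c K)\<^sup>2" by (simp add: power_mult_distrib power2_eq_square)
    then have "(9 ^ K * (81/100)) * lam \<le> u K" unfolding u_def using lam by (intro mult_mono) auto
    \<comment> \<open>By the choice of \<open>K\<close>, \<open>u K\<close> would be at least
      81/100, against the bound 1/8.\<close>
    then show False using u_le[of K] lam by (simp add: mult.assoc mult.left_commute)
  qed
qed

section \<open>Search and verification\<close>

text \<open>The suitable number of rounds is unknown, so all are tried. A failed stage falls through
  to the next smaller one.\<close>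

primrec search :: "nat \<Rightarrow> nat \<Rightarrow> nat \<Rightarrow> nat \<Rightarrow> (bool list option \<Rightarrow> prog) \<Rightarrow> prog" where
  "search n b m 0 c = trial m (stage n b m 0)
    (\<lambda>y. if pass n b 0 y then c (Some (take n y)) else c None)"
| "search n b m (Suc k) c = trial m (stage n b m (Suc k))
    (\<lambda>y. if pass n b (Suc k) y then c (Some (take n y)) else search n b m k c)"

definition vote :: "nat \<Rightarrow> nat \<Rightarrow> nat \<Rightarrow> bool list \<Rightarrow> (bool \<Rightarrow> prog) \<Rightarrow> prog" where
  "vote n b T x c = trial (n + T) (Fixed (flip (x @ replicate T False)) # votes n 0 b)
    (\<lambda>y. c (0 \<le> score n b y))"

text \<open>A random walk with \<open>t\<close> steps left, at height \<open>h\<close> with candidate \<open>x\<close>.  Height zero means that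
  there is no candidate; one that reaches height \<open>H\<close> is accepted.\<close>
primrec walk :: "nat \<Rightarrow> nat \<Rightarrow> nat \<Rightarrow> nat \<Rightarrow> nat \<Rightarrow> bool list \<Rightarrow> nat \<Rightarrow> prog" where
  "walk n b K H 0 = (\<lambda>x h. Halt NoSolution)"
| "walk n b K H (Suc t) = (\<lambda>x h.
    if h = H then Halt (Sol x)
    else if h = 0 then search n b (n + b * Suc K) K
      (case_option (walk n b K H t [] 0) (\<lambda>x. walk n b K H t x 1))
    else vote n b (b * Suc K) x (\<lambda>g. walk n b K H t x (if g then h + 1 else h - 1)))"

lemma wf_search:
  assumes "n + b * Suc k \<le> m" "wf_prog n m (c None)" "\<And>x. x \<in> basis n \<Longrightarrow> wf_prog n m (c (Some x))"
  shows "wf_prog n m (search n b m k c)"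
  using assms(1)
proof (induction k)
  case 0
  then have "n \<le> m" by simp
  then show ?case unfolding search.simps
    using 0 assms by (intro wf_trial wf_stage) (auto simp: basis_def)
next
  case (Suc k)
  then have "n \<le> m" by simp
  have "wf_prog n m (search n b m k c)" using Suc by simp
  then show ?case unfolding search.simps
    using \<open>n \<le> m\<close> Suc.prems assms by (intro wf_trial wf_stage) (auto simp: basis_def)
qed

lemma wf_vote:
  assumes "x \<in> basis n" "b \<le> T" "\<And>g. wf_prog n (n + T) (c g)"
  shows "wf_prog n (n + T) (vote n b T x c)"
proof -
  have "\<forall>g\<in>set (votes n 0 b). wf_gate n (n + T) g" using assms by (intro wf_votes) auto
  moreover have "x @ replicate T False \<in> basis (n + T)" using assms by (simp add: basis_def)
  ultimately show ?thesis
    unfolding vote_def using assms by (intro wf_trial) (auto simp: is_unitary_flip)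
qed

lemma wf_walk:
  assumes "h \<noteq> 0 \<Longrightarrow> x \<in> basis n"
  shows "wf_prog n (n + b * Suc K) (walk n b K H t x h)"
  using assms
proof (induction t arbitrary: x h)
  case (Suc t)
  consider "h = H" | "h \<noteq> H" "h = 0" | "h \<noteq> H" "h \<noteq> 0" by blast
  then show ?case
  proof cases
    case 2
    then show ?thesis using Suc.IH by (simp del: mult_Suc_right) (intro wf_search, auto)
  next
    case 3
    then show ?thesis using Suc by (simp del: mult_Suc_right) (intro wf_vote, auto)
  qed auto
qed simp

text \<open>The stage costs are geometric with ratio about 3: of \<open>b * 3 ^ Suc (Suc k)\<close>
  at most half goes to stage \<open>Suc k\<close>, and a third pays for all smaller stages.\<close>

lemma queries_search:
  assumes "n \<le> m" "queries (c None) \<le> B" "\<And>x. x \<in> basis n \<Longrightarrow> queries (c (Some x)) \<le> B"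
  shows "queries (search n b m k c) \<le> b * 3 ^ Suc k + B"
proof (induction k)
  case 0
  have "queries (search n b m 0 c) \<le> num_queries (stage n b m 0) + B"
    unfolding search.simps using assms by (intro queries_trial) (auto simp: basis_def)
  then show ?case using num_queries_stage[of n b m 0] by simp
next
  case (Suc k)
  have "queries (search n b m (Suc k) c) \<le> num_queries (stage n b m (Suc k)) + (b * 3 ^ Suc k + B)"
    unfolding search.simps(2)[of n b m k]
  proof (rule queries_trial)
    fix y assume "y \<in> basis m"
    then have "take n y \<in> basis n" using assms(1) by (simp add: basis_def)
    then show "queries (if pass n b (Suc k) y then c (Some (take n y)) else search n b m k c)
        \<le> b * 3 ^ Suc k + B"
      using assms(3) Suc by (auto intro: trans_le_add2)
  qed
  then show ?case using num_queries_stage[of n b m "Suc k"] by simp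
qed

text \<open>Every step is charged the price of a search; a vote needs only \<open>b\<close>
  queries.\<close>

lemma queries_walk: "queries (walk n b K H t x h) \<le> t * (b * 3 ^ Suc K)"
proof (induction t arbitrary: x h)
  case (Suc t)
  consider "h = H" | "h \<noteq> H" "h = 0" | "h \<noteq> H" "h \<noteq> 0" by blast
  then show ?case
  proof cases
    case 2
    have "queries (search n b (n + b * Suc K) K (case_option (walk n b K H t [] 0)
        (\<lambda>x. walk n b K H t x 1))) \<le> b * 3 ^ Suc K + t * (b * 3 ^ Suc K)"
      by (rule queries_search) (auto simp: Suc simp del: power_Suc)
    then show ?thesis using 2 by simp
  next
    case 3
    have "queries (vote n b (b * Suc K) x (\<lambda>g. walk n b K H t x (if g then h + 1 else h - 1)))
      \<le> num_queries (Fixed (flip (x @ replicate (b * Suc K) False)) # votes n 0 b) + t * (b * 3 ^ Suc K)"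
      unfolding vote_def by (rule queries_trial) (rule Suc)
    also have "\<dots> \<le> b * 3 ^ Suc K + t * (b * 3 ^ Suc K)"
      by (simp add: mult_le_mono2[of 1, simplified])
    finally show ?thesis using 3 by simp
  qed auto
qed simp

section \<open>Transition probabilities of searches and votes\<close>

lemma sum_amp:
  assumes "is_unitary n A"
  shows "(\<Sum>x\<in>basis n. (cmod (amp n A x))\<^sup>2) = 1"
proof -
  have "(\<Sum>x\<in>basis n. cnj (amp n A x) * amp n A x) = 1"
    using assms by (simp add: is_unitary_def amp_def)
  then have "complex_of_real (\<Sum>x\<in>basis n. (cmod (amp n A x))\<^sup>2) = of_real 1"
    by (simp add: cnj_mult_self)
  then show ?thesis unfolding of_real_eq_iff .
qed

lemma prob_flag_trial:
  assumes "is_unitary n A" "is_unitary (Suc n) Q" "b * Suc k \<le> T"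
  shows "prob (n + T) A Q R (trial (n + T) (stage n b (n + T) k)
      (\<lambda>y. if pass n b k y then c (take n y) else d)) =
    (\<Sum>x\<in>basis n. cand_weight n b T A Q k x * prob (n + T) A Q R (c x)) +
    (1 - flag_weight n b (n + T) A Q k) * prob (n + T) A Q R d"
proof -
  let ?m = "n + T"
  let ?w = "\<lambda>y. (cmod (circ_sem ?m A Q (stage n b ?m k) (init ?m) y))\<^sup>2"
  have wf: "\<forall>g\<in>set (stage n b ?m k). wf_gate n ?m g"
    using assms by (intro wf_stage) simp
  have "prob ?m A Q R (trial ?m (stage n b ?m k) (\<lambda>y. if pass n b k y then c (take n y) else d)) =
      (\<Sum>y\<in>basis ?m. (if pass n b k y then ?w y * prob ?m A Q R (c (take n y)) else 0)
        + (?w y - (if pass n b k y then ?w y else 0)) * prob ?m A Q R d)"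
    unfolding prob_trial by (intro sum.cong) auto
  also have "\<dots> = (\<Sum>y\<in>basis ?m. if pass n b k y then ?w y * prob ?m A Q R (c (take n y)) else 0)
      + (1 - flag_weight n b ?m A Q k) * prob ?m A Q R d"
    unfolding sum.distrib sum_distrib_right[symmetric] sum_subtractf
      sum_circ_sem_init[OF assms(1,2) wf] flag_weight_def by (simp add: sum.inter_filter)
  also have "(\<Sum>y\<in>basis ?m. if pass n b k y then ?w y * prob ?m A Q R (c (take n y)) else 0) =
      (\<Sum>x\<in>basis n. cand_weight n b T A Q k x * prob ?m A Q R (c x))"
    unfolding sum_basis_append
  proof (rule sum.cong)
    fix x assume "x \<in> basis n"
    then have "(\<Sum>v\<in>basis T. if pass n b k (x @ v) then ?w (x @ v) * prob ?m A Q R (c (take n (x @ v))) else 0) =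
        (\<Sum>v\<in>basis T. if pass n b k (x @ v) then ?w (x @ v) * prob ?m A Q R (c x) else 0)"
      by (simp add: basis_def cong: if_cong)
    also have "\<dots> = cand_weight n b T A Q k x * prob ?m A Q R (c x)"
      by (auto simp: cand_weight_def sum_distrib_right sum.inter_filter intro!: sum.cong)
    finally show "(\<Sum>v\<in>basis T. if pass n b k (x @ v)
        then ?w (x @ v) * prob ?m A Q R (c (take n (x @ v))) else 0) =
        cand_weight n b T A Q k x * prob ?m A Q R (c x)" .
  qed simp
  finally show ?thesis .
qed

text \<open>\<open>\<pi> x\<close> is the probability that the search returns \<open>x\<close>. It
  is chosen before the continuation \<open>c\<close> and the event \<open>R\<close>, so the walk
  sees a fixed transition law. Summing over the stages bounds \<open>\<pi>\<close> from above; any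
  single flagged weight bounds the total from below.\<close>

lemma prob_search:
  assumes U: "is_unitary n A" "is_unitary (Suc n) Q" and "b * Suc k \<le> T"
  shows "\<exists>\<pi>. (\<forall>x. 0 \<le> \<pi> x \<and> \<pi> x \<le> (\<Sum>l\<le>k. cand_weight n b T A Q l x)) \<and> sum \<pi> (basis n) \<le> 1 \<and>
    (\<forall>l\<le>k. flag_weight n b (n + T) A Q l \<le> sum \<pi> (basis n)) \<and>
    (\<forall>c R. prob (n + T) A Q R (search n b (n + T) k c) =
      (\<Sum>x\<in>basis n. \<pi> x * prob (n + T) A Q R (c (Some x))) +
      (1 - sum \<pi> (basis n)) * prob (n + T) A Q R (c None))"
  using assms(3)
proof (induction k)
  case 0
  have "prob (n + T) A Q R (search n b (n + T) 0 c) =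
      (\<Sum>x\<in>basis n. cand_weight n b T A Q 0 x * prob (n + T) A Q R (c (Some x))) +
      (1 - sum (cand_weight n b T A Q 0) (basis n)) * prob (n + T) A Q R (c None)" for c R
    using prob_flag_trial[OF U 0, of R "\<lambda>x. c (Some x)" "c None"] by (simp add: flag_weight_eq)
  then show ?case
    using flag_weight_bounds[OF U 0]
    by (intro exI[of _ "cand_weight n b T A Q 0"]) (simp add: cand_weight_nonneg flag_weight_eq)
next
  case (Suc k)
  let ?s = "flag_weight n b (n + T) A Q (Suc k)"
  obtain \<pi> where \<pi>: "\<And>x. 0 \<le> \<pi> x" "\<And>x. \<pi> x \<le> (\<Sum>l\<le>k. cand_weight n b T A Q l x)"
      "sum \<pi> (basis n) \<le> 1" "\<And>l. l \<le> k \<Longrightarrow> flag_weight n b (n + T) A Q l \<le> sum \<pi> (basis n)"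
    and pr: "\<And>c R. prob (n + T) A Q R (search n b (n + T) k c) =
      (\<Sum>x\<in>basis n. \<pi> x * prob (n + T) A Q R (c (Some x))) +
      (1 - sum \<pi> (basis n)) * prob (n + T) A Q R (c None)"
    using Suc by auto
  \<comment> \<open>Either the longest stage succeeds with \<open>x\<close>, or it fails and the
    shorter search decides.\<close>
  define \<pi>' where "\<pi>' x = cand_weight n b T A Q (Suc k) x + (1 - ?s) * \<pi> x" for x
  have s: "0 \<le> ?s" "?s \<le> 1" using flag_weight_bounds[OF U Suc.prems] by auto
  have sum': "sum \<pi>' (basis n) = ?s + (1 - ?s) * sum \<pi> (basis n)"
    by (simp add: \<pi>'_def sum.distrib flag_weight_eq sum_distrib_left)
  have rest: "1 - sum \<pi>' (basis n) = (1 - ?s) * (1 - sum \<pi> (basis n))"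
    by (simp add: sum' algebra_simps)
  have "\<pi>' x \<le> (\<Sum>l\<le>Suc k. cand_weight n b T A Q l x)" for x
    using s \<pi>(1)[of x] \<pi>(2)[of x] mult_left_le_one_le[of "\<pi> x" "1 - ?s"] by (simp add: \<pi>'_def)
  moreover have "0 \<le> \<pi>' x" for x using s \<pi> by (simp add: \<pi>'_def cand_weight_nonneg)
  moreover have "0 \<le> 1 - sum \<pi>' (basis n)" unfolding rest using s \<pi> by simp
  moreover have "flag_weight n b (n + T) A Q l \<le> sum \<pi>' (basis n)" if "l \<le> Suc k" for l
  proof (cases "l = Suc k")
    case True
    then show ?thesis using s \<pi> by (simp add: sum' sum_nonneg)
  next
    case False
    then have "flag_weight n b (n + T) A Q l \<le> sum \<pi> (basis n)" using that \<pi> by simp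
    also have "\<dots> \<le> sum \<pi>' (basis n)"
      using s mult_nonneg_nonneg[of ?s "1 - sum \<pi> (basis n)"] \<pi>(3) by (simp add: sum' algebra_simps)
    finally show ?thesis .
  qed
  moreover have "prob (n + T) A Q R (search n b (n + T) (Suc k) c) =
      (\<Sum>x\<in>basis n. \<pi>' x * prob (n + T) A Q R (c (Some x))) +
      (1 - sum \<pi>' (basis n)) * prob (n + T) A Q R (c None)" for c R
    unfolding search.simps prob_flag_trial[OF U Suc.prems, of R "\<lambda>x. c (Some x)"] pr rest \<pi>'_def
    by (simp add: sum.distrib distrib_left distrib_right sum_distrib_left mult.assoc)
  ultimately show ?case by (intro exI[of _ \<pi>']) auto
qed

text \<open>\<open>q\<close> is the probability of a wrong majority, again the same for all
  continuations.\<close>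

lemma prob_vote:
  assumes Q: "bounded_error_oracle n p f Q" and p: "1/2 < p" "p < 1" and x: "x \<in> basis n" and b: "b \<le> T"
  shows "\<exists>q. 0 \<le> q \<and> q \<le> (2 * sqrt (p * (1 - p))) ^ b \<and>
    (\<forall>c R. prob (n + T) A Q R (vote n b T x c) =
      q * prob (n + T) A Q R (c (\<not> f x)) + (1 - q) * prob (n + T) A Q R (c (f x)))"
proof -
  let ?m = "n + T"
  let ?z = "x @ replicate T False"
  let ?w = "\<lambda>v. vote_prob n Q T b (x @ v)"
  define wrong where "wrong v \<longleftrightarrow> (0 \<le> score n b (x @ v)) \<noteq> f x" for v
  define q where "q = (\<Sum>v\<in>{v\<in>basis T. wrong v}. ?w v)"
  have z: "?z \<in> basis ?m" using x by (simp add: basis_def)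
  have "q \<le> (\<Sum>v\<in>{v\<in>basis T. 0 \<le> (\<Sum>i<b. if v ! i \<noteq> f x then 1 else - 1 :: int)}. ?w v)"
    unfolding q_def
  proof (rule sum_mono2)
    have "(\<Sum>i<b. if v ! i \<noteq> f x then 1 else - 1 :: int) =
        (if f x then - score n b (x @ v) else score n b (x @ v))" for v
      unfolding score_append[OF x] by (auto simp: sum_negf[symmetric] intro!: sum.cong)
    then show "{v \<in> basis T. wrong v} \<subseteq>
        {v \<in> basis T. 0 \<le> (\<Sum>i<b. if v ! i \<noteq> f x then 1 else - 1 :: int)}"
      by (auto simp: wrong_def split: if_splits)
  qed (auto simp: vote_prob_nonneg)
  also have "\<dots> \<le> (2 * sqrt (p * (1 - p))) ^ b" by (rule wrong_majority[OF Q p x order_refl b])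
  finally have q: "q \<le> (2 * sqrt (p * (1 - p))) ^ b" .
  have q0: "0 \<le> q" by (simp add: q_def sum_nonneg vote_prob_nonneg)
  have "prob ?m A Q R (vote n b T x c) = q * prob ?m A Q R (c (\<not> f x)) + (1 - q) * prob ?m A Q R (c (f x))"
    for c R
  proof -
    let ?P = "\<lambda>g. prob ?m A Q R (c g)"
    define g where "g y = (if take n y = x then 1 else 0 :: complex)" for y
    have flipped: "gate_sem ?m A Q (Fixed (flip ?z)) (init ?m) y = g y * vote_amp n Q T 0 y"
      if y: "y \<in> basis ?m" for y
    proof -
      have "init ?m = (\<lambda>y. if y = replicate ?m False then 1 else 0)" by (simp add: init_def)
      then have "gate_sem ?m A Q (Fixed (flip ?z)) (init ?m) y = (if y = ?z then 1 else 0)"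
        using z map2_neq_False[of ?z] x by (simp add: apply_full_flip basis_def)
      also have "\<dots> = g y * (if drop n y = replicate T False then 1 else 0)"
        using y x by (auto simp: g_def basis_def) (metis append_take_drop_id)
      also have "\<dots> = g y * vote_amp n Q T 0 y"
        using vote_amp_0[of "take n y" n "drop n y" T Q] y by (simp add: basis_def)
      finally show ?thesis .
    qed
    have amp: "circ_sem ?m A Q (Fixed (flip ?z) # votes n 0 b) (init ?m) y = g y * vote_amp n Q T b y"
      if "y \<in> basis ?m" for y
      unfolding circ_sem_Cons using that b
      by (intro circ_sem_votes[OF oracle_marks[OF Q] _ _ flipped]) (auto simp: g_def)
    have "prob ?m A Q R (vote n b T x c) =
        (\<Sum>y\<in>basis ?m. (if take n y = x then vote_prob n Q T b y else 0) * ?P (0 \<le> score n b y))"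
      unfolding vote_def prob_trial
      by (intro sum.cong) (auto simp: amp g_def vote_prob_def simp del: circ_sem_Cons)
    also have "\<dots> = (\<Sum>x'\<in>basis n. if x' = x then \<Sum>v\<in>basis T. ?w v * ?P (0 \<le> score n b (x @ v)) else 0)"
      unfolding sum_basis_append by (intro sum.cong) (auto simp: basis_def)
    also have "\<dots> = (\<Sum>v\<in>basis T. ?w v * ?P (0 \<le> score n b (x @ v)))" using x by simp
    also have "\<dots> = (\<Sum>v\<in>basis T. (if wrong v then ?w v else 0) * ?P (\<not> f x)
        + (?w v - (if wrong v then ?w v else 0)) * ?P (f x))"
      by (intro sum.cong) (auto simp: wrong_def)
    also have "\<dots> = q * ?P (\<not> f x) + (1 - q) * ?P (f x)"
      unfolding sum.distrib sum_distrib_right[symmetric] sum_subtractf sum_vote_prob[OF Q p x] q_def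
      by (simp add: sum.inter_filter)
    finally show ?thesis .
  qed
  then show ?thesis using q q0 by blast
qed

section \<open>Analysis of the random walk\<close>

lemma sum_filter_split:
  "finite S \<Longrightarrow> (\<Sum>x\<in>S. w x) = (\<Sum>x\<in>{x\<in>S. P x}. w x) + (\<Sum>x\<in>{x\<in>S. \<not> P x}. w x)"
  using sum.Int_Diff[of S w "{x. P x}"] by (simp add: Int_def set_diff_eq)

context
  fixes n b K :: nat and A Q :: qop and f :: "bool list \<Rightarrow> bool" and p :: real
  assumes A: "is_unitary n A" and Q: "bounded_error_oracle n p f Q" and p: "1/2 < p" "p < 1"
    and b: "(2 * sqrt (p * (1 - p))) ^ b \<le> 1/1000"
begin

lemma unitary_Q: "is_unitary (Suc n) Q"
  using Q by (simp add: bounded_error_oracle_def)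

text \<open>Here \<open>g\<close> and \<open>h\<close> are the good and bad flagged weights without
  their growth factor, to which \<open>amplification_sequence\<close> applies. Bad returns are rare
  for every \<open>lam\<close>, whereas the 1/16 for returning anything needs enough rounds. That
  strings of amplitude zero are never returned matters when there is no good state.\<close>

lemma search_outcome:
  defines "m \<equiv> n + b * Suc K"
  shows "\<exists>\<pi>. (\<forall>x. 0 \<le> \<pi> x) \<and> sum \<pi> (basis n) \<le> 1 \<and>
    (\<Sum>x\<in>{x\<in>basis n. \<not> f x}. \<pi> x) \<le> 1/500 \<and>
    (\<forall>x\<in>basis n. amp n A x = 0 \<longrightarrow> \<pi> x = 0) \<and>
    (\<forall>lam. 0 < lam \<longrightarrow> lam \<le> (\<Sum>x\<in>{x\<in>basis n. f x}. (cmod (amp n A x))\<^sup>2) \<longrightarrow> 1 \<le> 9 ^ K * lam \<longrightarrow>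
      1/16 \<le> sum \<pi> (basis n)) \<and>
    (\<forall>c R. prob m A Q R (search n b m K c) =
      (\<Sum>x\<in>basis n. \<pi> x * prob m A Q R (c (Some x))) +
      (1 - sum \<pi> (basis n)) * prob m A Q R (c None))"
proof -
  let ?T = "b * Suc K"
  let ?s = "flag_weight n b m A Q"
  let ?\<beta> = "(2 * sqrt (p * (1 - p))) ^ b"
  let ?a = "\<lambda>x. (cmod (amp n A x))\<^sup>2"
  define c where "c k = (\<Prod>l<k. 3 - 4 * ?s l)" for k
  define g where "g k = (\<Sum>x\<in>{x\<in>basis n. f x}. ?a x * pass_prob n b ?T Q k x)" for k
  define h where "h k = (\<Sum>x\<in>{x\<in>basis n. \<not> f x}. ?a x * pass_prob n b ?T Q k x)" for k
  define G where "G = (\<Sum>x\<in>{x\<in>basis n. f x}. ?a x)"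
  have \<beta>: "0 \<le> ?\<beta>" using p by simp
  have T: "b * Suc k \<le> ?T" if "k \<le> K" for k using that by (intro mult_le_mono2) simp
  have cand: "cand_weight n b ?T A Q k x = (c k)\<^sup>2 * (?a x * pass_prob n b ?T Q k x)"
    if "k \<le> K" "x \<in> basis n" for k x
    using cand_weight_eq[OF A Q T[OF that(1)] that(2)] by (simp add: c_def m_def)
  have s: "?s k = (c k)\<^sup>2 * g k + (c k)\<^sup>2 * h k" if "k \<le> K" for k
  proof -
    have "?s k = (\<Sum>x\<in>basis n. (c k)\<^sup>2 * (?a x * pass_prob n b ?T Q k x))"
      unfolding m_def flag_weight_eq using that cand by (intro sum.cong) auto
    also have "\<dots> = (c k)\<^sup>2 * (g k + h k)"
      unfolding sum_distrib_left[symmetric] g_def h_def by (simp add: sum_filter_split[of "basis n" _ f])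
    finally show ?thesis by (simp add: distrib_left)
  qed
  have s01: "0 \<le> ?s k" "?s k \<le> 1" if "k \<le> K" for k
    using flag_weight_bounds[OF A unitary_Q T[OF that]] by (simp_all add: m_def)
  have P0: "0 \<le> pass_prob n b ?T Q k x" for k x
    by (simp add: pass_prob_def sum_nonneg vote_prob_nonneg)
  have h0: "0 \<le> h k" for k using P0 by (simp add: h_def sum_nonneg)
  have h_le: "h k \<le> ?\<beta> ^ Suc k" if "k \<le> K" for k
  proof -
    have "h k \<le> (\<Sum>x\<in>{x\<in>basis n. \<not> f x}. ?a x * ?\<beta> ^ Suc k)"
      unfolding h_def
      by (intro sum_mono mult_left_mono pass_prob_bad[OF Q p _ _ T[OF that]]) auto
    also have "\<dots> \<le> (\<Sum>x\<in>basis n. ?a x * ?\<beta> ^ Suc k)"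
      using \<beta> by (intro sum_mono2) auto
    finally show ?thesis by (simp only: sum_distrib_right[symmetric] sum_amp[OF A] mult_1)
  qed
  have g_ge: "G / 2 \<le> g k" if "k \<le> K" for k
  proof -
    have "1/2 \<le> pass_prob n b ?T Q k x" if x: "x \<in> basis n" "f x" for x
    proof -
      have "(\<Sum>l\<le>k. ?\<beta> ^ Suc l) = ?\<beta> * (\<Sum>l<Suc k. ?\<beta> ^ l)"
        by (simp only: sum_distrib_left power_Suc lessThan_Suc_atMost)
      also have "\<dots> \<le> ?\<beta> * 2" using \<beta> b by (intro mult_left_mono sum_power_le_2) auto
      also have "\<dots> \<le> 1/2" using b by simp
      finally show ?thesis using pass_prob_good[OF Q p x T[OF \<open>k \<le> K\<close>]] by linarith
    qed
    then have "(\<Sum>x\<in>{x\<in>basis n. f x}. ?a x * (1/2)) \<le> g k"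
      unfolding g_def by (intro sum_mono mult_left_mono) auto
    then show ?thesis by (simp add: G_def sum_divide_distrib)
  qed
  have g_le: "g k \<le> G" for k
    unfolding g_def G_def using pass_prob_le_1[OF Q p] P0
    by (intro sum_mono) (auto intro: mult_left_le)
  note seq = amplification_sequence[of c ?s K g h ?\<beta>, OF c_def s s01 h0 h_le \<beta> b]
  obtain \<pi> where \<pi>: "\<And>x. 0 \<le> \<pi> x" "\<And>x. \<pi> x \<le> (\<Sum>l\<le>K. cand_weight n b ?T A Q l x)"
      "sum \<pi> (basis n) \<le> 1" "\<And>l. l \<le> K \<Longrightarrow> ?s l \<le> sum \<pi> (basis n)"
    and pr: "\<And>c R. prob m A Q R (search n b m K c) =
      (\<Sum>x\<in>basis n. \<pi> x * prob m A Q R (c (Some x))) +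
      (1 - sum \<pi> (basis n)) * prob m A Q R (c None)"
    using prob_search[OF A unitary_Q, of b K ?T] unfolding m_def by auto
  have "(\<Sum>x\<in>{x\<in>basis n. \<not> f x}. \<pi> x) \<le>
      (\<Sum>x\<in>{x\<in>basis n. \<not> f x}. \<Sum>l\<le>K. cand_weight n b ?T A Q l x)"
    by (intro sum_mono \<pi>)
  also have "\<dots> = (\<Sum>l\<le>K. \<Sum>x\<in>{x\<in>basis n. \<not> f x}. cand_weight n b ?T A Q l x)"
    by (rule sum.swap)
  also have "\<dots> = (\<Sum>l\<le>K. (c l)\<^sup>2 * h l)"
    unfolding h_def sum_distrib_left using cand by (intro sum.cong) auto
  also have "\<dots> \<le> 1/500" using seq(1) b by simp
  finally have bad: "(\<Sum>x\<in>{x\<in>basis n. \<not> f x}. \<pi> x) \<le> 1/500" .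
  have zero: "\<pi> x = 0" if "x \<in> basis n" "amp n A x = 0" for x
  proof -
    have "(\<Sum>l\<le>K. cand_weight n b ?T A Q l x) = 0"
      using cand that by (intro sum.neutral) auto
    then show ?thesis using \<pi>(1)[of x] \<pi>(2)[of x] by linarith
  qed
  have "1/16 \<le> sum \<pi> (basis n)" if "0 < lam" "lam \<le> G" "1 \<le> 9 ^ K * lam" for lam
  proof -
    have "\<exists>k\<le>K. 1/16 \<le> ?s k" by (rule seq(2)[OF _ _ _ _ g_ge g_le that])
    then show ?thesis using \<pi>(4) by force
  qed
  then show ?thesis
    using \<pi> pr bad zero by (intro exI[of _ \<pi>]) (simp add: G_def)
qed

text \<open>As in gambler's ruin, \<open>4 ^ h\<close> shrinks on average under votes on a bad
  candidate, so height \<open>H\<close> is reached from \<open>h\<close> with probability at most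
  about \<open>4 ^ h / 4 ^ H\<close>. The term linear in \<open>t\<close> pays for restarts at
  height one.\<close>

lemma walk_no_solution:
  assumes none: "\<forall>x\<in>basis n. f x \<longrightarrow> amp n A x = 0" and H: "0 < H"
    and "h \<le> H" "h \<noteq> 0 \<Longrightarrow> x \<in> basis n \<and> \<not> f x"
  shows "1 - (1/4) ^ H * 4 ^ h - (1/4) ^ H * 4 * real t \<le>
    prob (n + b * Suc K) A Q {NoSolution} (walk n b K H t x h)"
  using assms(3,4)
proof (induction t arbitrary: x h)
  case 0
  then show ?case by (simp add: prob_Halt)
next
  case (Suc t)
  let ?m = "n + b * Suc K"
  let ?P = "prob ?m A Q {NoSolution}"
  define e where "e = (1/4 :: real) ^ H"
  have e0: "0 < e" and e1: "e * 4 ^ H = 1" by (simp_all add: e_def flip: power_mult_distrib)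
  consider "h = H" | "h \<noteq> H" "h = 0" | "h \<noteq> H" "h \<noteq> 0" by blast
  then show ?case
  proof cases
    case 1
    then show ?thesis using e0 e1 by (simp add: prob_Halt e_def)
  next
    case 2
    obtain \<pi> where \<pi>: "\<And>x. 0 \<le> \<pi> x" "sum \<pi> (basis n) \<le> 1"
        "\<And>x. x \<in> basis n \<Longrightarrow> amp n A x = 0 \<Longrightarrow> \<pi> x = 0"
      and pr: "\<And>c R. prob ?m A Q R (search n b ?m K c) =
        (\<Sum>x\<in>basis n. \<pi> x * prob ?m A Q R (c (Some x))) +
        (1 - sum \<pi> (basis n)) * prob ?m A Q R (c None)"
      using search_outcome by blast
    \<comment> \<open>The bound at height one. Returning no candidate is even better, so
      \<open>v\<close> serves whatever the search returns.\<close>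
    define v where "v = 1 - e * 4 - e * 4 * real t"
    have "\<pi> x * v \<le> \<pi> x * ?P (walk n b K H t x 1)" if "x \<in> basis n" for x
    proof (cases "f x")
      case True
      \<comment> \<open>Strings with \<open>f x\<close> have amplitude zero here, so the search
        never returns one.\<close>
      then show ?thesis using \<pi>(3) none that by simp
    next
      case False
      then show ?thesis using Suc.IH[of 1 x] H that \<pi>(1)[of x]
        by (intro mult_left_mono) (auto simp: v_def e_def)
    qed
    then have "sum \<pi> (basis n) * v \<le> (\<Sum>x\<in>basis n. \<pi> x * ?P (walk n b K H t x 1))"
      unfolding sum_distrib_right by (intro sum_mono)
    moreover have "v \<le> ?P (walk n b K H t [] 0)"
    proof -
      have "1 - e - e * 4 * real t \<le> ?P (walk n b K H t [] 0)"
        using Suc.IH[of 0 "[]"] by (simp add: e_def)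
      then show ?thesis using e0 by (simp add: v_def)
    qed
    then have "(1 - sum \<pi> (basis n)) * v \<le> (1 - sum \<pi> (basis n)) * ?P (walk n b K H t [] 0)"
      using \<pi>(2) by (intro mult_left_mono) auto
    ultimately have "v \<le> ?P (search n b ?m K (case_option (walk n b K H t [] 0)
        (\<lambda>x. walk n b K H t x 1)))"
      unfolding pr by (simp add: algebra_simps)
    moreover have "1 - e - e * 4 * real (Suc t) \<le> v" using e0 by (simp add: v_def algebra_simps)
    ultimately show ?thesis using 2 by (simp add: e_def)
  next
    case 3
    then have x: "x \<in> basis n" "\<not> f x" and h: "h < H" using Suc.prems by auto
    obtain q where q: "0 \<le> q" "q \<le> (2 * sqrt (p * (1 - p))) ^ b"
      and pr: "\<And>c R. prob ?m A Q R (vote n b (b * Suc K) x c) =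
        q * prob ?m A Q R (c True) + (1 - q) * prob ?m A Q R (c False)"
      using prob_vote[OF Q p x(1), of b "b * Suc K" A] x(2) by auto
    obtain k where k: "h = Suc k" using 3 by (cases h) auto
    define w where "w = e * 4 ^ k"
    have w: "0 \<le> w" using e0 by (simp add: w_def)
    have "1 - w * 16 - e * 4 * real t \<le> ?P (walk n b K H t x (h + 1))"
      using Suc.IH[of "h + 1" x] h x by (simp add: e_def w_def k mult_ac)
    then have 1: "q * (1 - w * 16 - e * 4 * real t) \<le> q * ?P (walk n b K H t x (h + 1))"
      using q by (intro mult_left_mono) auto
    have "1 - w - e * 4 * real t \<le> ?P (walk n b K H t x (h - 1))"
      using Suc.IH[of "h - 1" x] h x by (simp add: e_def w_def k mult_ac)
    then have 2: "(1 - q) * (1 - w - e * 4 * real t) \<le> (1 - q) * ?P (walk n b K H t x (h - 1))"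
      using q b by (intro mult_left_mono) auto
    \<comment> \<open>The expected potential after the vote is \<open>(1 + 15 * q) * w\<close>, well
      below its present value \<open>4 * w\<close>.\<close>
    have "q * w \<le> 1/1000 * w" using q b w by (intro mult_right_mono) auto
    then have "1 - w * 4 - e * 4 * real (Suc t) \<le>
        q * (1 - w * 16 - e * 4 * real t) + (1 - q) * (1 - w - e * 4 * real t)"
      using e0 w by (simp add: algebra_simps)
    also have "\<dots> \<le> ?P (vote n b (b * Suc K) x (\<lambda>g. walk n b K H t x (if g then h + 1 else h - 1)))"
      unfolding pr using 1 2 by simp
    finally have "1 - w * 4 - e * 4 * real (Suc t) \<le> ?P (walk n b K H (Suc t) x h)"
      using 3 by simp
    moreover have "e * 4 ^ h = w * 4" by (simp add: w_def k)
    ultimately show ?thesis by (simp add: e_def)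
  qed
qed

text \<open>The potential \<open>M\<close> contracts by the factor \<open>63/64\<close> per step on average; \<open>M'\<close> bounds the
  probability of accepting the current candidate although it is bad, and every search adds
  at most \<open>4 * (1/4) ^ H\<close> to it.\<close>
lemma walk_solution:
  assumes lam: "0 < lam" "lam \<le> (\<Sum>x\<in>{x\<in>basis n. f x}. (cmod (amp n A x))\<^sup>2)" "1 \<le> 9 ^ K * lam"
    and H: "0 < H" and "h \<le> H" "h \<noteq> 0 \<Longrightarrow> x \<in> basis n"
  defines "M \<equiv> \<lambda>x h. if f x then (1/2) ^ h else 2 ^ h :: real"
    and "M' \<equiv> \<lambda>x h. if f x then 1 else 4 ^ h :: real"
  shows "1 - (63/64) ^ t * 2 ^ H * M x h - (1/4) ^ H * M' x h - (1/4) ^ H * 4 * real t \<le>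
    prob (n + b * Suc K) A Q (Sol ` {x\<in>basis n. f x}) (walk n b K H t x h)"
  using assms(5,6)
proof (induction t arbitrary: x h)
  case 0
  \<comment> \<open>With no steps left the claimed lower bound is at most zero, because
    \<open>2 ^ H * M x h\<close> is at least one at every height.\<close>
  have "(1/2) ^ H \<le> M x h"
  proof (cases "f x")
    case True
    then show ?thesis using 0 by (simp add: M_def power_decreasing)
  next
    case False
    have "(1/2 :: real) ^ H \<le> 1" by (simp add: power_le_one)
    also have "(1 :: real) \<le> 2 ^ h" by simp
    finally show ?thesis using False by (simp add: M_def)
  qed
  then have "2 ^ H * (1/2) ^ H \<le> 2 ^ H * M x h" by (intro mult_left_mono) auto
  then have "1 \<le> 2 ^ H * M x h" by (simp flip: power_mult_distrib)
  moreover have "0 \<le> (1/4) ^ H * M' x h" by (simp add: M'_def)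
  ultimately show ?case by (simp add: prob_Halt)
next
  case (Suc t)
  let ?m = "n + b * Suc K"
  let ?P = "prob ?m A Q (Sol ` {x\<in>basis n. f x})"
  define e where "e = (1/4 :: real) ^ H"
  define d where "d = (63/64 :: real) ^ t * 2 ^ H"
  have e0: "0 < e" and e1: "e * 4 ^ H = 1" by (simp_all add: e_def flip: power_mult_distrib)
  have d0: "0 < d" by (simp add: d_def)
  have IH: "1 - d * M x h - e * M' x h - e * 4 * real t \<le> ?P (walk n b K H t x h)"
    if "h \<le> H" "h \<noteq> 0 \<Longrightarrow> x \<in> basis n" for x h
    using Suc.IH[OF that] by (simp add: e_def d_def)
  have "1 - d * (63/64) * M x h - e * M' x h - e * 4 * real (Suc t) \<le> ?P (walk n b K H (Suc t) x h)"
  proof -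
    consider "h = H" | "h \<noteq> H" "h = 0" | "h \<noteq> H" "h \<noteq> 0" by blast
    then show ?thesis
    proof cases
      case 1
      have "0 \<le> M x h" "0 \<le> M' x h" by (simp_all add: M_def M'_def)
      then have "0 \<le> d * M x h" "0 \<le> e * M' x h" "0 \<le> e * real t" using d0 e0 by simp_all
      then have "1 - d * (63/64) * M x h - e * M' x h - e * 4 * real (Suc t) \<le> 1 - e * M' x h"
        using e0 by (simp add: algebra_simps)
      moreover have "0 \<le> e * M' x h" by fact
      moreover have "e * M' x h = 1" if "\<not> f x" using that 1 e1 by (simp add: M'_def)
      moreover have "?P (walk n b K H (Suc t) x h) = (if f x then 1 else 0)"
        using 1 H Suc.prems by (auto simp: prob_Halt)
      ultimately show ?thesis by (cases "f x") auto
    next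
      case 2
      obtain \<pi> where \<pi>: "\<And>x. 0 \<le> \<pi> x" "sum \<pi> (basis n) \<le> 1"
          "(\<Sum>x\<in>{x\<in>basis n. \<not> f x}. \<pi> x) \<le> 1/500" "1/16 \<le> sum \<pi> (basis n)"
        and pr: "\<And>c R. prob ?m A Q R (search n b ?m K c) =
          (\<Sum>x\<in>basis n. \<pi> x * prob ?m A Q R (c (Some x))) +
          (1 - sum \<pi> (basis n)) * prob ?m A Q R (c None)"
        using search_outcome lam by blast
      define \<gamma> where "\<gamma> = (\<Sum>x\<in>{x\<in>basis n. f x}. \<pi> x)"
      define \<mu> where "\<mu> = (\<Sum>x\<in>{x\<in>basis n. \<not> f x}. \<pi> x)"
      have \<gamma>\<mu>: "sum \<pi> (basis n) = \<gamma> + \<mu>"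
        unfolding \<gamma>_def \<mu>_def by (rule sum_filter_split) simp
      have pos: "0 \<le> \<gamma>" "0 \<le> \<mu>" using \<pi>(1) by (simp_all add: \<gamma>_def \<mu>_def sum_nonneg)
      define r where "r = e * 4 * real t"
      have cond: "\<pi> x * (1 - d * M x 1 - e * M' x 1 - r) \<le> \<pi> x * ?P (walk n b K H t x 1)"
        if "x \<in> basis n" for x
        using IH[of 1 x] that H \<pi>(1)[of x] by (intro mult_left_mono) (auto simp: r_def)
      have "\<gamma> * (1 - d / 2 - e - r) + \<mu> * (1 - d * 2 - e * 4 - r) =
          (\<Sum>x\<in>basis n. \<pi> x * (1 - d * M x 1 - e * M' x 1 - r))"
        unfolding sum_filter_split[of "basis n" _ f, OF finite_basis] \<gamma>_def \<mu>_def sum_distrib_right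
        by (intro arg_cong2[of _ _ _ _ "(+)"] sum.cong) (auto simp: M_def M'_def)
      also have "\<dots> \<le> (\<Sum>x\<in>basis n. \<pi> x * ?P (walk n b K H t x 1))"
        by (intro sum_mono cond)
      finally have some: "\<gamma> * (1 - d / 2 - e - r) + \<mu> * (1 - d * 2 - e * 4 - r) \<le>
          (\<Sum>x\<in>basis n. \<pi> x * ?P (walk n b K H t x 1))" .
      \<comment> \<open>At height zero the string is a mere leftover; \<open>M\<close> and
        \<open>M'\<close> are both one there, whether or not \<open>f\<close> holds.\<close>
      have none: "(1 - (\<gamma> + \<mu>)) * (1 - d - e - r) \<le> (1 - (\<gamma> + \<mu>)) * ?P (walk n b K H t [] 0)"
        using IH[of 0 "[]"] \<pi>(2) \<gamma>\<mu>
        by (intro mult_left_mono) (auto simp: r_def M_def M'_def split: if_splits)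
      \<comment> \<open>Origin of 63/64. A search changes \<open>M\<close> from 1 to
        \<open>1 - \<gamma> / 2 + \<mu>\<close> on average, and
        \<open>\<gamma> + \<mu> \<ge> 1/16\<close> with \<open>\<mu> \<le> 1/500\<close> makes the
        decrease larger than 1/64.\<close>
      have "d * (1/64) \<le> d * (\<gamma> / 2 - \<mu>)"
        using \<pi>(3,4) d0 \<gamma>\<mu> unfolding \<mu>_def[symmetric] by (intro mult_left_mono) auto
      moreover have "e * \<mu> \<le> e" using \<pi>(2) \<gamma>\<mu> pos e0 by (intro mult_left_le) auto
      moreover have "\<gamma> * (1 - d / 2 - e - r) + \<mu> * (1 - d * 2 - e * 4 - r) + (1 - (\<gamma> + \<mu>)) * (1 - d - e - r) =
          1 - d * (63/64) - e - e * 4 * real (Suc t) +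
          (d * (\<gamma> / 2 - \<mu>) - d * (1/64)) + (4 * e - 3 * (e * \<mu>))"
        by (simp add: r_def field_simps)
      ultimately have "1 - d * (63/64) - e - e * 4 * real (Suc t) \<le>
          \<gamma> * (1 - d / 2 - e - r) + \<mu> * (1 - d * 2 - e * 4 - r) + (1 - (\<gamma> + \<mu>)) * (1 - d - e - r)"
        using e0 by linarith
      also have "\<dots> \<le> ?P (search n b ?m K (case_option (walk n b K H t [] 0)
          (\<lambda>x. walk n b K H t x 1)))"
        unfolding pr \<gamma>\<mu> using some none by simp
      finally show ?thesis using 2 by (simp add: M_def M'_def)
    next
      case 3
      then have x: "x \<in> basis n" and h: "h < H" using Suc.prems by auto
      obtain q where q: "0 \<le> q" "q \<le> (2 * sqrt (p * (1 - p))) ^ b"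
        and pr: "\<And>c R. prob ?m A Q R (vote n b (b * Suc K) x c) =
          q * prob ?m A Q R (c (\<not> f x)) + (1 - q) * prob ?m A Q R (c (f x))"
        using prob_vote[OF Q p x, of b "b * Suc K" A] by auto
      obtain k where k: "h = Suc k" using 3 by (cases h) auto
      have up: "1 - d * M x (h + 1) - e * M' x (h + 1) - e * 4 * real t \<le> ?P (walk n b K H t x (h + 1))"
        using IH[of "h + 1" x] h x by simp
      have down: "1 - d * M x (h - 1) - e * M' x (h - 1) - e * 4 * real t \<le> ?P (walk n b K H t x (h - 1))"
        using IH[of "h - 1" x] h x by simp
      have q1: "q \<le> 1/1000" using q b by simp
      have vote: "q * (1 - d * M x u - e * M' x u - e * 4 * real t) +
          (1 - q) * (1 - d * M x u' - e * M' x u' - e * 4 * real t) \<le>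
          ?P (vote n b (b * Suc K) x (\<lambda>g. walk n b K H t x (if g then h + 1 else h - 1)))"
        if "u = (if f x then h - 1 else h + 1)" "u' = (if f x then h + 1 else h - 1)" for u u'
        unfolding pr using up down q q1 that
        by (intro add_mono mult_left_mono) auto
      \<comment> \<open>A vote multiplies \<open>M\<close> by \<open>1/2 + 3/2 * q\<close> on
        average, upwards for a good candidate and downwards for a bad one, so there is ample room
        below 63/64.\<close>
      have "1 - d * (63/64) * M x h - e * M' x h - e * 4 * real (Suc t) \<le>
          q * (1 - d * M x (if f x then h - 1 else h + 1) - e * M' x (if f x then h - 1 else h + 1)
            - e * 4 * real t) +
          (1 - q) * (1 - d * M x (if f x then h + 1 else h - 1)
            - e * M' x (if f x then h + 1 else h - 1) - e * 4 * real t)"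
      proof (cases "f x")
        case True
        define w where "w = d * (1/2) ^ k"
        have w0: "0 \<le> w" using d0 by (simp add: w_def)
        have qw: "q * w \<le> 1/1000 * w" using q1 w0 by (intro mult_right_mono) auto
        have MM: "M x h = (1/2) ^ k / 2" "M x (h - 1) = (1/2) ^ k" "M x (h + 1) = (1/2) ^ k / 4"
          "M' x i = 1" for i
          using True by (simp_all add: M_def M'_def k)
        have l: "1 - d * (63/64) * M x h - e * M' x h - e * 4 * real (Suc t) =
            1 - 63/128 * w - e - e * 4 * real (Suc t)"
          by (simp add: MM w_def)
        have r: "q * (1 - d * M x (h - 1) - e * M' x (h - 1) - e * 4 * real t) +
            (1 - q) * (1 - d * M x (h + 1) - e * M' x (h + 1) - e * 4 * real t) =
            1 - e - e * 4 * real (Suc t) + 4 * e - w / 4 - 3/4 * (q * w)"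
          unfolding MM w_def by (simp add: field_simps)
        show ?thesis unfolding l by (simp only: True if_True r) (use qw e0 w0 in linarith)
      next
        case False
        define w where "w = d * 2 ^ k"
        define z where "z = e * 4 ^ k"
        have wz: "0 \<le> w" "0 \<le> z" using d0 e0 by (simp_all add: w_def z_def)
        have qw: "q * w \<le> 1/1000 * w" "q * z \<le> 1/1000 * z"
          using q1 wz by (intro mult_right_mono; simp)+
        have MM: "M x h = 2 ^ k * 2" "M x (h - 1) = 2 ^ k" "M x (h + 1) = 2 ^ k * 4"
          "M' x h = 4 ^ k * 4" "M' x (h - 1) = 4 ^ k" "M' x (h + 1) = 4 ^ k * 16"
          using False by (simp_all add: M_def M'_def k)
        have l: "1 - d * (63/64) * M x h - e * M' x h - e * 4 * real (Suc t) =
            1 - 63/32 * w - 4 * z - e * 4 * real (Suc t)"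
          by (simp add: MM w_def z_def)
        have r: "q * (1 - d * M x (h + 1) - e * M' x (h + 1) - e * 4 * real t) +
            (1 - q) * (1 - d * M x (h - 1) - e * M' x (h - 1) - e * 4 * real t) =
            1 - e * 4 * real (Suc t) + 4 * e - w - z - 3 * (q * w) - 15 * (q * z)"
          unfolding MM w_def z_def by (simp add: field_simps)
        show ?thesis unfolding l by (simp only: False if_False r) (use qw e0 wz in linarith)
      qed
      also have "\<dots> \<le> ?P (vote n b (b * Suc K) x (\<lambda>g. walk n b K H t x (if g then h + 1 else h - 1)))"
        by (rule vote) simp_all
      finally show ?thesis using 3 by simp
    qed
  qed
  then show ?case by (simp add: d_def e_def mult_ac)
qed

end

section \<open>Choice of parameters\<close>

text \<open>The Hadamard gate on the first qubit, the only source of randomness in the query-free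
  program.\<close>

definition hadamard :: qop where
  "hadamard y x = (if tl y = tl x then (if hd y \<and> hd x then - 1 else 1) / sqrt 2 else 0)"

lemma is_unitary_hadamard: "is_unitary (Suc k) hadamard"
  unfolding is_unitary_def
proof (intro ballI)
  fix x x' :: "bool list" assume "x \<in> basis (Suc k)" "x' \<in> basis (Suc k)"
  then obtain c u c' u' where x: "x = c # u" "u \<in> basis k" "x' = c' # u'" "u' \<in> basis k"
    by (auto simp: basis_def length_Suc_conv)
  have two: "complex_of_real (sqrt 2) * complex_of_real (sqrt 2) = 2"
    by (simp flip: of_real_mult)
  have "cnj (hadamard (d # v) x) * hadamard (d # v) x' =
      (if v = u then if u = u' then (if d \<and> c \<noteq> c' then - 1 else 1) / 2 else 0 else 0)" for d v
    by (auto simp: hadamard_def x two)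
  then show "(\<Sum>y\<in>basis (Suc k). cnj (hadamard y x) * hadamard y x') = (if x = x' then 1 else 0)"
    using x by (simp add: sum_basis_Cons)
qed

definition coin :: "nat \<Rightarrow> prog" where
  "coin n = trial n [Fixed hadamard] (\<lambda>y. if hd y then Halt NoSolution
    else trial n [UseA [0..<n]] (\<lambda>x. Halt (Sol x)))"

lemma prob_coin:
  assumes "1 \<le> n" "finite R"
  shows "prob n A Q R (coin n) = (\<Sum>x\<in>{x\<in>basis n. Sol x \<in> R}. (cmod (amp n A x))\<^sup>2) / 2 +
    (if NoSolution \<in> R then 1/2 else 0)"
proof -
  obtain k where n: "n = Suc k" using assms(1) by (cases n) auto
  have had: "(cmod (circ_sem n A Q [Fixed hadamard] (init n) (c # t)))\<^sup>2 =
      (if t = replicate k False then 1/2 else 0)" if "t \<in> basis k" for c t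
  proof -
    have "circ_sem n A Q [Fixed hadamard] (init n) (c # t) = hadamard (c # t) (replicate n False)"
      by (simp add: apply_full_def init_def if_distrib[of "\<lambda>z. _ * z"] cong: if_cong)
    then show ?thesis by (auto simp: hadamard_def n norm_divide power_divide)
  qed
  have prep: "circ_sem n A Q [UseA [0..<n]] (init n) y = amp n A y" if "y \<in> basis n" for y
    using gate_sem_prepare[of y n 0 A Q Q] that by (simp add: vote_amp_def basis_def)
  have "prob n A Q R (trial n [UseA [0..<n]] (\<lambda>x. Halt (Sol x))) =
      (\<Sum>x\<in>basis n. if Sol x \<in> R then (cmod (amp n A x))\<^sup>2 else 0)"
    unfolding prob_trial using assms(2)
    by (intro sum.cong) (simp_all add: prep prob_Halt del: circ_sem_Cons)
  then have "prob n A Q R (trial n [UseA [0..<n]] (\<lambda>x. Halt (Sol x))) =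
      (\<Sum>x\<in>{x\<in>basis n. Sol x \<in> R}. (cmod (amp n A x))\<^sup>2)"
    by (simp add: sum.inter_filter)
  moreover have "prob n A Q R (coin n) =
      prob n A Q R (trial n [UseA [0..<n]] (\<lambda>x. Halt (Sol x))) / 2 + prob n A Q R (Halt NoSolution) / 2"
  proof -
    have "prob n A Q R (coin n) = (\<Sum>y\<in>basis (Suc k).
        (cmod (circ_sem n A Q [Fixed hadamard] (init n) y))\<^sup>2 * prob n A Q R (if hd y then Halt NoSolution
          else trial n [UseA [0..<n]] (\<lambda>x. Halt (Sol x))))"
      unfolding coin_def prob_trial by (simp add: n)
    then show ?thesis
      by (simp add: sum_basis_Cons had if_distrib[of "\<lambda>z. z * _"] del: circ_sem_Cons cong: if_cong)
  qed
  ultimately show ?thesis using assms(2) by (simp add: prob_Halt)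
qed

lemma wf_coin:
  assumes "1 \<le> n"
  shows "wf_prog n n (coin n)"
proof -
  obtain k where "n = Suc k" using assms by (cases n) auto
  then have "is_unitary n hadamard" by (simp add: is_unitary_hadamard)
  then show ?thesis unfolding coin_def by (intro wf_trial) (auto intro!: wf_trial)
qed

lemma queries_coin: "queries (coin n) = 0"
proof -
  have "queries (coin n) \<le> num_queries [Fixed hadamard] + 0"
    unfolding coin_def
  proof (rule queries_trial)
    fix y
    have "queries (trial n [UseA [0..<n]] (\<lambda>x. Halt (Sol x))) \<le> num_queries [UseA [0..<n]] + 0"
      by (rule queries_trial) simp
    then show "queries (if hd y then Halt NoSolution else trial n [UseA [0..<n]] (\<lambda>x. Halt (Sol x))) \<le> 0"
      by simp
  qed
  then show ?thesis by simp
qed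

text \<open>The square of the Chernoff base is \<open>1 - 4 * \<epsilon>^2\<close>, at most
  \<open>exp (- 4 * \<epsilon>^2)\<close>. With \<open>b\<close> at least
  \<open>5 / \<epsilon>^2\<close> the power drops to \<open>exp (- 10)\<close>, which is below
  \<open>2 ^ 10\<close> inverted.\<close>

lemma exists_vote_count:
  assumes p: "1/2 < p" "p < (1::real)"
  obtains b where "(2 * sqrt (p * (1 - p))) ^ b \<le> 1/1000" "real b \<le> 12 * p / (p - 1/2)\<^sup>2"
proof -
  define \<epsilon> where "\<epsilon> = p - 1/2"
  have \<epsilon>: "0 < \<epsilon>" "\<epsilon> < 1/2" using p by (auto simp: \<epsilon>_def)
  define b where "b = nat \<lceil>5 / \<epsilon>\<^sup>2\<rceil>"
  have b1: "5 / \<epsilon>\<^sup>2 \<le> b" unfolding b_def by (rule real_nat_ceiling_ge)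
  have "0 \<le> \<lceil>5 / \<epsilon>\<^sup>2\<rceil>" using zero_le_power2[of \<epsilon>] by (simp add: less_le_trans[of "-1" 0])
  then have b2: "b \<le> 5 / \<epsilon>\<^sup>2 + 1"
    using of_int_ceiling_le_add_one[of "5 / \<epsilon>\<^sup>2"] by (simp add: b_def)
  have "2 * sqrt (p * (1 - p)) \<le> exp (- 2 * \<epsilon>\<^sup>2)"
  proof (rule power2_le_imp_le)
    have "(2 * sqrt (p * (1 - p)))\<^sup>2 = 1 + - 4 * \<epsilon>\<^sup>2"
      using p by (simp add: power_mult_distrib \<epsilon>_def power2_eq_square algebra_simps)
    also have "\<dots> \<le> exp (- 4 * \<epsilon>\<^sup>2)" by (rule exp_ge_add_one_self)
    also have "\<dots> = (exp (- 2 * \<epsilon>\<^sup>2))\<^sup>2" by (simp flip: exp_double)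
    finally show "(2 * sqrt (p * (1 - p)))\<^sup>2 \<le> (exp (- 2 * \<epsilon>\<^sup>2))\<^sup>2" .
  qed simp
  then have "(2 * sqrt (p * (1 - p))) ^ b \<le> exp (- 2 * \<epsilon>\<^sup>2) ^ b"
    using p by (intro power_mono) auto
  also have "\<dots> = exp (- (2 * \<epsilon>\<^sup>2 * b))" by (simp add: mult_ac flip: exp_of_nat_mult)
  also have "\<dots> \<le> exp (- 10)" using b1 \<epsilon> by (simp add: field_simps)
  also have "\<dots> \<le> 1/1000"
  proof -
    have "(2::real) ^ 10 \<le> exp 1 ^ 10" using exp_ge_add_one_self[of 1] by (intro power_mono) auto
    also have "\<dots> = exp 10" by (simp flip: exp_of_nat_mult)
    finally show ?thesis by (simp add: exp_minus field_simps)
  qed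
  finally have 1: "(2 * sqrt (p * (1 - p))) ^ b \<le> 1/1000" .
  have "\<epsilon>\<^sup>2 \<le> 1\<^sup>2" using \<epsilon> by (intro power_mono) auto
  then have "1 \<le> 1 / \<epsilon>\<^sup>2" using \<epsilon> by simp
  \<comment> \<open>Rounding up costs at most one, hence at most \<open>1 / \<epsilon>^2\<close>;
    next, \<open>p > 1/2\<close> turns 6 into \<open>12 * p\<close>.\<close>
  then have "real b \<le> 6 / \<epsilon>\<^sup>2" using b2 by simp
  also have "\<dots> \<le> 12 * p / \<epsilon>\<^sup>2" using p by (intro divide_right_mono) auto
  finally show ?thesis using 1 by (intro that) (auto simp: \<epsilon>_def)
qed

lemma exists_least_power:
  fixes a z :: real
  assumes "1 < a" "1 \<le> z"
  obtains k where "z \<le> a ^ k" "a ^ k \<le> a * z"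
proof -
  define k where "k = (LEAST k. z \<le> a ^ k)"
  obtain k0 where "z < a ^ k0" using real_arch_pow[OF assms(1)] by blast
  then have ge: "z \<le> a ^ k" unfolding k_def using LeastI[of "\<lambda>k. z \<le> a ^ k" k0] by simp
  have "a ^ k \<le> a * z"
  proof (cases k)
    case 0
    then show ?thesis using assms mult_mono[of 1 a 1 z] by simp
  next
    case (Suc j)
    have "\<not> z \<le> a ^ j" using not_less_Least[of j "\<lambda>k. z \<le> a ^ k"] Suc by (simp add: k_def)
    then show ?thesis using assms Suc by simp
  qed
  then show ?thesis using ge that by blast
qed

text \<open>With 128 steps per unit of height, \<open>(63/64) ^ 128 \<le> 1/4\<close> beats the
  factor \<open>2 ^ H\<close> and leaves \<open>(1/2) ^ H\<close>. The restart terms carry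
  \<open>(1/4) ^ H\<close>, and half of that exponential absorbs their linear factor.\<close>

lemma walk_error:
  fixes H :: nat
  assumes "20 \<le> H"
  shows "(63/64) ^ (128 * H) * 2 ^ H + (1/4) ^ H + (1/4) ^ H * 4 * real (128 * H) \<le> 2 * (1/2 :: real) ^ H"
proof -
  have "(63/64 :: real) ^ (128 * H) * 2 ^ H = ((63/64) ^ 128 * 2) ^ H"
    by (simp add: power_mult power_mult_distrib)
  also have "\<dots> \<le> (1/2) ^ H"
  proof (rule power_mono)
    \<comment> \<open>Seven squarings, rounded up on the way, to keep the numerals short.\<close>
    have "(63/64 :: real) ^ 128 = ((((((((63/64)^2)^2)^2)^2)^2)^2)^2)" by simp
    also have "\<dots> \<le> 1/4"
    proof -
      have "((63/64 :: real)^2)^2 \<le> 94/100" by (simp add: power2_eq_square)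
      then have "(((63/64 :: real)^2)^2)^2 \<le> (94/100)^2" by (rule power_mono) simp
      also have "\<dots> \<le> 89/100" by (simp add: power2_eq_square)
      finally have "((((63/64 :: real)^2)^2)^2)^2 \<le> (89/100)^2" by (rule power_mono) simp
      also have "\<dots> \<le> 80/100" by (simp add: power2_eq_square)
      finally have "(((((63/64 :: real)^2)^2)^2)^2)^2 \<le> (80/100)^2" by (rule power_mono) simp
      also have "\<dots> \<le> 65/100" by (simp add: power2_eq_square)
      finally have "((((((63/64 :: real)^2)^2)^2)^2)^2)^2 \<le> (65/100)^2" by (rule power_mono) simp
      also have "\<dots> \<le> 1/2" by (simp add: power2_eq_square)
      finally have "(((((((63/64 :: real)^2)^2)^2)^2)^2)^2)^2 \<le> (1/2)^2" by (rule power_mono) simp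
      also have "\<dots> = 1/4" by (simp add: power2_eq_square)
      finally show ?thesis .
    qed
    finally show "(63/64 :: real) ^ 128 * 2 \<le> 1/2" by simp
  qed simp
  finally have 1: "(63/64 :: real) ^ (128 * H) * 2 ^ H \<le> (1/2) ^ H" .
  have "1 + 512 * real H \<le> 2 ^ H" using assms
  proof (induction H rule: dec_induct)
    case (step H)
    then have "real H \<ge> 20" by simp
    then show ?case using step by simp
  qed simp
  then have "(1/4 :: real) ^ H * (1 + 512 * real H) \<le> (1/4) ^ H * 2 ^ H" by (intro mult_left_mono) auto
  also have "\<dots> = (1/2) ^ H" by (simp flip: power_mult_distrib)
  finally show ?thesis using 1 by (simp add: algebra_simps)
qed

lemma ln_2_ge: "1/2 \<le> ln (2::real)"
  using ln_le_minus_one[of "1/2 :: real"] by (simp add: ln_div)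

lemma walk_correct:
  fixes n b K H :: nat
  assumes A: "is_unitary n A" and Q: "bounded_error_oracle n p f Q" and p: "1/2 < p" "p < 1"
    and b: "(2 * sqrt (p * (1 - p))) ^ b \<le> 1/1000"
    and K: "0 < lam" "1 \<le> 9 ^ K * lam" and H: "20 \<le> H" "2 * (1/2) ^ H \<le> \<delta>"
  defines "m \<equiv> n + b * Suc K" and "P \<equiv> walk n b K H (128 * H) [] 0"
  shows "lam \<le> (\<Sum>x\<in>{x\<in>basis n. f x}. (cmod (amp n A x))\<^sup>2) \<Longrightarrow> 1 - \<delta> \<le> success_prob n m A Q f P"
    and "\<forall>x\<in>basis n. f x \<longrightarrow> amp n A x = 0 \<Longrightarrow> 1 - \<delta> \<le> nosol_prob m A Q P"
proof -
  note err = walk_error[OF H(1)]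
  have H0: "0 < H" using H by simp
  have "0 \<le> (63/64) ^ (128 * H) * (2 :: real) ^ H" by simp
  then have err': "(1/4) ^ H + (1/4) ^ H * 4 * real (128 * H) \<le> 2 * (1/2 :: real) ^ H"
    using err by linarith
  show "1 - \<delta> \<le> success_prob n m A Q f P"
    if "lam \<le> (\<Sum>x\<in>{x\<in>basis n. f x}. (cmod (amp n A x))\<^sup>2)"
    using walk_solution[OF A Q p b K(1) that K(2) H0, where h = 0 and x = "[]" and t = "128 * H"] err H(2)
    unfolding success_prob_eq m_def P_def by (simp split: if_splits)
  show "1 - \<delta> \<le> nosol_prob m A Q P" if "\<forall>x\<in>basis n. f x \<longrightarrow> amp n A x = 0"
    using walk_no_solution[OF A Q p b that H0, where K = K and h = 0 and x = "[]" and t = "128 * H"] err' H(2)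
    unfolding nosol_prob_eq m_def P_def by simp
qed

theorem theorem3:
  "\<exists>C::real. C > 0 \<and>
    (\<forall>(n::nat) (p::real) (\<delta>::real) (lam::real).
       1 \<le> n \<longrightarrow> 1/2 < p \<longrightarrow> p < 1 \<longrightarrow> 0 < \<delta> \<longrightarrow> \<delta> < 1 \<longrightarrow> 0 < lam \<longrightarrow> lam \<le> 1 \<longrightarrow>
       (\<exists>(m::nat) (P::prog).
          wf_prog n m P \<and>
          real (queries P) \<le> C * (p / ((p - 1/2)\<^sup>2 * sqrt lam)) * ln (1 / (lam * \<delta>)) \<and>
          real m \<le> real n + C * (2 * p / (p - 1/2)\<^sup>2) * ln (1 / (lam * \<delta>)) \<and>
          (\<forall>(A::qop) (f::bool list \<Rightarrow> bool) (Q::qop).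
             is_unitary n A \<longrightarrow> bounded_error_oracle n p f Q \<longrightarrow>
             (((\<exists>x\<in>basis n. f x \<and> amp n A x \<noteq> 0) \<and>
               lam = Min {(cmod (amp n A x))\<^sup>2 | x. x \<in> basis n \<and> f x \<and> amp n A x \<noteq> 0})
                \<longrightarrow> success_prob n m A Q f P \<ge> 1 - \<delta>) \<and>
             ((\<forall>x\<in>basis n. f x \<longrightarrow> amp n A x = 0)
                \<longrightarrow> nosol_prob m A Q P \<ge> 1 - \<delta>))))"
proof -
  \<comment> \<open>The minimum enters as a lower bound for the total good weight, to which the
    search responds.\<close>
  have good_weight: "lam \<le> (\<Sum>x\<in>{x\<in>basis n. f x}. (cmod (amp n A x))\<^sup>2)"
    if ex: "\<exists>x\<in>basis n. f x \<and> amp n A x \<noteq> 0"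
      and lam: "lam = Min {(cmod (amp n A x))\<^sup>2 | x. x \<in> basis n \<and> f x \<and> amp n A x \<noteq> 0}"
    for n A f and lam :: real
  proof -
    obtain x where x: "x \<in> basis n" "f x" "amp n A x \<noteq> 0" using ex by blast
    have "lam \<le> (cmod (amp n A x))\<^sup>2"
      unfolding lam by (rule Min_le) (use x in auto)
    also have "\<dots> \<le> (\<Sum>x\<in>{x\<in>basis n. f x}. (cmod (amp n A x))\<^sup>2)"
      using x by (intro member_le_sum) auto
    finally show ?thesis .
  qed
  have main: "\<exists>m P. wf_prog n m P \<and>
      real (queries P) \<le> 1000000 * (p / ((p - 1/2)\<^sup>2 * sqrt lam)) * ln (1 / (lam * \<delta>)) \<and>
      real m \<le> real n + 1000000 * (2 * p / (p - 1/2)\<^sup>2) * ln (1 / (lam * \<delta>)) \<and>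
      (\<forall>A f Q. is_unitary n A \<longrightarrow> bounded_error_oracle n p f Q \<longrightarrow>
        (lam \<le> (\<Sum>x\<in>{x\<in>basis n. f x}. (cmod (amp n A x))\<^sup>2) \<longrightarrow> 1 - \<delta> \<le> success_prob n m A Q f P) \<and>
        ((\<forall>x\<in>basis n. f x \<longrightarrow> amp n A x = 0) \<longrightarrow> 1 - \<delta> \<le> nosol_prob m A Q P))"
    if n: "1 \<le> n" and p: "1/2 < p" "p < 1" and \<delta>: "0 < \<delta>" "\<delta> < 1" and lam: "0 < lam" "lam \<le> 1"
    for n :: nat and p \<delta> lam :: real
  proof -
    define L where "L = ln (1 / (lam * \<delta>))"
    have L_eq: "L = ln (1 / lam) + ln (1 / \<delta>)"
      using \<delta> lam by (simp add: L_def ln_div ln_mult)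
    have L0: "0 \<le> ln (1 / lam)" "0 \<le> ln (1 / \<delta>)" using \<delta> lam by (simp_all add: ln_div)
    show ?thesis
    proof (cases "2/3 < lam * \<delta>")
      case True
      have "lam * \<delta> \<le> lam" "lam * \<delta> \<le> \<delta>" using \<delta> lam by (simp_all add: mult_left_le mult_left_le_one_le)
      \<comment> \<open>With both above 2/3, the coin answers correctly with probability at least
        \<open>lam / 2 > 1/3\<close> or exactly 1/2, and \<open>1 - \<delta>\<close> is below
        1/3.\<close>
      then have big: "2/3 < lam" "2/3 < \<delta>" using True by auto
      have coin_ok: "(lam \<le> (\<Sum>x\<in>{x\<in>basis n. f x}. (cmod (amp n A x))\<^sup>2) \<longrightarrow>
            1 - \<delta> \<le> success_prob n n A Q f (coin n)) \<and> 1 - \<delta> \<le> nosol_prob n A Q (coin n)" for A f Q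
      proof -
        have "{x \<in> basis n. Sol x \<in> Sol ` {x \<in> basis n. f x}} = {x \<in> basis n. f x}" by auto
        then show ?thesis
          using big n by (auto simp: success_prob_eq nosol_prob_eq prob_coin)
      qed
      have "0 \<le> L" using L_eq L0 by simp
      then have "0 \<le> 1000000 * (p / ((p - 1/2)\<^sup>2 * sqrt lam)) * L"
          "0 \<le> 1000000 * (2 * p / (p - 1/2)\<^sup>2) * L" using p lam by simp_all
      then show ?thesis
        using coin_ok wf_coin[OF n]
        by (intro exI[of _ n] exI[of _ "coin n"]) (simp add: queries_coin flip: L_def)
    next
      case False
      \<comment> \<open>From here on additive constants can be absorbed into multiples of
        \<open>L\<close>.\<close>
      have "1/3 \<le> L"
      proof -
        have "ln (lam * \<delta>) \<le> lam * \<delta> - 1" using \<delta> lam by (intro ln_le_minus_one) simp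
        then show ?thesis using False \<delta> lam by (simp add: L_def ln_div)
      qed
      define z where "z = p / (p - 1/2)\<^sup>2"
      have z0: "0 \<le> z" using p by (simp add: z_def)
      obtain b where b: "(2 * sqrt (p * (1 - p))) ^ b \<le> 1/1000" "real b \<le> 12 * z"
        using exists_vote_count[OF p] unfolding z_def by (metis times_divide_eq_right)
      obtain K where K: "1 / lam \<le> 9 ^ K" "9 ^ K \<le> 9 * (1 / lam)"
        using exists_least_power[of 9 "1 / lam"] lam by auto
      \<comment> \<open>The factor \<open>2 ^ 20\<close> forces \<open>20 \<le> H\<close>, as
        \<open>walk_error\<close> requires, and leaves the error far below
        \<open>\<delta>\<close>.\<close>
      obtain H where H: "2 ^ 20 / \<delta> \<le> 2 ^ H" "2 ^ H \<le> 2 * (2 ^ 20 / \<delta>)"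
        using exists_least_power[of 2 "2 ^ 20 / \<delta>"] \<delta> by auto
      have "(2::real) ^ 20 \<le> 2 ^ 20 / \<delta>" using \<delta> by (simp add: field_simps)
      then have "(2::real) ^ 20 \<le> 2 ^ H" using H(1) by linarith
      then have H20: "20 \<le> H" by (rule power_le_imp_le_exp[rotated]) simp
      have "2 * (1/2) ^ H \<le> \<delta>" using H(1) \<delta> by (simp add: power_one_over field_simps)
      have K1: "1 \<le> 9 ^ K * lam" using K(1) lam by (simp add: field_simps)
      have K3: "3 ^ K \<le> 3 / sqrt lam"
      proof (rule power2_le_imp_le)
        have "(3 ^ K)\<^sup>2 = (9 :: real) ^ K" by (simp add: power2_eq_square flip: power_mult_distrib)
        then show "(3 ^ K)\<^sup>2 \<le> (3 / sqrt lam)\<^sup>2" using K(2) lam by (simp add: power_divide)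
      qed (use lam in simp)
      \<comment> \<open>\<open>K\<close> is at most \<open>1 + ln (1 / lam)\<close>, and the
        remaining constant 2 is at most \<open>6 * L\<close>.\<close>
      have KL: "real (Suc K) \<le> 7 * L"
      proof -
        have "real K * ln 9 \<le> ln 9 + ln (1 / lam)"
          using K(2) lam by (simp flip: ln_realpow ln_mult_pos)
        moreover have "1 \<le> ln (9::real)"
          using exp_le by (subst ln_ge_iff) auto
        ultimately have "(real K - 1) * 1 \<le> ln (1 / lam)"
          using L0(1)
        proof (cases "K = 0")
          case False
          then have "(real K - 1) * 1 \<le> (real K - 1) * ln 9"
            using \<open>1 \<le> ln 9\<close> by (intro mult_left_mono) auto
          also have "\<dots> \<le> ln (1 / lam)"
            using \<open>real K * ln 9 \<le> ln 9 + ln (1 / lam)\<close> by (simp add: left_diff_distrib)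
          finally show ?thesis .
        qed simp
        then show ?thesis using L_eq L0 \<open>1/3 \<le> L\<close> by simp
      qed
      \<comment> \<open>\<open>H\<close> is at most \<open>21 + 2 * ln (1 / \<delta>)\<close>, where
        21 is at most \<open>63 * L\<close>.\<close>
      have HL: "real H \<le> 65 * L"
      proof -
        have "real H * ln 2 \<le> 21 * ln 2 + ln (1 / \<delta>)"
        proof -
          have "real H * ln 2 = ln (2 ^ H)" by (simp add: ln_realpow)
          also have "\<dots> \<le> ln (2 ^ 21 * (1 / \<delta>))" using H(2) \<delta> by (intro ln_mono) auto
          also have "\<dots> = 21 * ln 2 + ln (1 / \<delta>)" using \<delta> ln_realpow[of 2 21] by (subst ln_mult_pos) auto
          finally show ?thesis .
        qed
        then have "(real H - 21) * ln 2 \<le> ln (1 / \<delta>)" by (simp add: algebra_simps)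
        moreover have "(real H - 21) * (1/2) \<le> (real H - 21) * ln 2" if "21 \<le> real H"
          using that ln_2_ge by (intro mult_left_mono) auto
        ultimately have "real H \<le> 21 + 2 * ln (1 / \<delta>)" using L0(2) by (cases "21 \<le> real H") auto
        then show ?thesis using L_eq L0 \<open>1/3 \<le> L\<close> by simp
      qed
      define P where "P = walk n b K H (128 * H) [] 0"
      have "real (queries P) \<le> real (128 * H * (b * 3 ^ Suc K))"
        unfolding P_def of_nat_le_iff by (rule queries_walk)
      also have "\<dots> = 384 * (real H * (real b * 3 ^ K))" by simp
      \<comment> \<open>Steps, votes per test and cost of the longest stage are bounded separately:
        384 is 128 times the 3 from \<open>3 ^ Suc K\<close>.\<close>
      also have "\<dots> \<le> 384 * ((65 * L) * ((12 * z) * (3 / sqrt lam)))"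
        using HL b(2) K3 z0 \<open>1/3 \<le> L\<close> lam by (intro mult_left_mono mult_mono) auto
      also have "\<dots> = 898560 * (p / ((p - 1/2)\<^sup>2 * sqrt lam)) * L"
        by (simp add: z_def)
      also have "\<dots> \<le> 1000000 * (p / ((p - 1/2)\<^sup>2 * sqrt lam)) * L"
        using p lam \<open>1/3 \<le> L\<close> by (intro mult_right_mono) auto
      finally have q: "real (queries P) \<le> 1000000 * (p / ((p - 1/2)\<^sup>2 * sqrt lam)) * L" .
      have "real b * real (Suc K) \<le> (12 * z) * (7 * L)"
        using b(2) KL z0 by (intro mult_mono) auto
      also have "\<dots> \<le> 1000000 * (2 * z) * L" using z0 \<open>1/3 \<le> L\<close> by simp
      finally have "real (n + b * Suc K) \<le> real n + 1000000 * (2 * p / (p - 1/2)\<^sup>2) * L"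
        by (simp add: z_def distrib_left)
      moreover have "wf_prog n (n + b * Suc K) P" unfolding P_def by (rule wf_walk) simp
      ultimately show ?thesis
        using q walk_correct[OF _ _ p b(1) lam(1) K1 H20 \<open>2 * (1/2) ^ H \<le> \<delta>\<close>]
        unfolding P_def L_def by (intro exI[of _ "n + b * Suc K"] exI[of _ "walk n b K H (128 * H) [] 0"]) blast
    qed
  qed
  show ?thesis
  proof (intro exI[of _ "1000000::real"] conjI allI impI)
    fix n :: nat and p \<delta> lam :: real
    assume "1 \<le> n" "1/2 < p" "p < 1" "0 < \<delta>" "\<delta> < 1" "0 < lam" "lam \<le> 1"
    from main[OF this] obtain m P where mP: "wf_prog n m P"
      "real (queries P) \<le> 1000000 * (p / ((p - 1/2)\<^sup>2 * sqrt lam)) * ln (1 / (lam * \<delta>))"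
      "real m \<le> real n + 1000000 * (2 * p / (p - 1/2)\<^sup>2) * ln (1 / (lam * \<delta>))"
      "\<forall>A f Q. is_unitary n A \<longrightarrow> bounded_error_oracle n p f Q \<longrightarrow>
        (lam \<le> (\<Sum>x\<in>{x\<in>basis n. f x}. (cmod (amp n A x))\<^sup>2) \<longrightarrow> 1 - \<delta> \<le> success_prob n m A Q f P) \<and>
        ((\<forall>x\<in>basis n. f x \<longrightarrow> amp n A x = 0) \<longrightarrow> 1 - \<delta> \<le> nosol_prob m A Q P)"
      by blast
    then show "\<exists>m P. wf_prog n m P \<and>
      real (queries P) \<le> 1000000 * (p / ((p - 1/2)\<^sup>2 * sqrt lam)) * ln (1 / (lam * \<delta>)) \<and>
      real m \<le> real n + 1000000 * (2 * p / (p - 1/2)\<^sup>2) * ln (1 / (lam * \<delta>)) \<and>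
      (\<forall>A f Q. is_unitary n A \<longrightarrow> bounded_error_oracle n p f Q \<longrightarrow>
        ((\<exists>x\<in>basis n. f x \<and> amp n A x \<noteq> 0) \<and>
          lam = Min {(cmod (amp n A x))\<^sup>2 | x. x \<in> basis n \<and> f x \<and> amp n A x \<noteq> 0} \<longrightarrow>
          success_prob n m A Q f P \<ge> 1 - \<delta>) \<and>
        ((\<forall>x\<in>basis n. f x \<longrightarrow> amp n A x = 0) \<longrightarrow> nosol_prob m A Q P \<ge> 1 - \<delta>))"
      using good_weight by (intro exI[of _ m] exI[of _ P]) blast
  qed simp
qed

end
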